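(* Given the linear quantum stochastic system $dx = (\mathbb{J}_{2n} R -\tfrac{1}{2}C^{\sharp}C) x\, dt -C^{\sharp}\Sigma\, d\mathcal{U}$, $d\mathcal{Y} = C x\, dt + \Sigma\, d\mathcal{U}$, there exists a real symplectic transformation $V$ such that the following hold: 1. The transformed states $\begin{pmatrix} \hat{q} \\ \hat{p} \end{pmatrix}=\hat{x} = Vx= V \begin{pmatrix} q \\ p \end{pmatrix}$ can be partitioned as $\hat{q}=\begin{pmatrix}\hat{q}_a \\ \hat{q}_b \\ \hat{q}_c\end{pmatrix}$, $\hat{p}=\begin{pmatrix}\hat{p}_a \\ \hat{p}_b \\ \hat{p}_c\end{pmatrix}$, with $\hat{q}_a,\hat{p}_a\in$ ($k\times 1$), $\hat{q}_b,\hat{p}_b$ ($l\times 1$), $\hat{q}_c,\hat{p}_c$ ($(n-k-l)\times 1$), where (a) the states $\hat{q}_a$ and $\hat{p}_a$ are both controllable and observable; (b) the states $\hat{p}_b$ are controllable but unobservable; (c) the states $\hat{q}_b$ are uncontrollable but observable; (d) the states $\hat{q}_c$ and $\hat{p}_c$ are both uncontrollable and unobservable. 2. In the transformed states the system takes the form $d\hat{x} = \hat{A}\hat{x}\,dt + \hat{B}\,d\mathcal{U}$, $d\mathcal{Y} = \hat{C}\hat{x}\,dt + D\, d\mathcal{U}$ (with $D=\Sigma$), where, with respect to the ordering $(\hat{q}_a,\hat{q}_b,\hat{q}_c,\hat{p}_a,\hat{p}_b,\hat{p}_c)$, $\hat{A}=\begin{pmatrix} A_{co,11} & A_{13,1}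 & 0 & A_{co,12} & 0 & 0 \\ 0 & A_{\bar{c}o} & 0 & 0 & 0 & 0 \\ 0 & A_{43,1} & A_{\bar{c}\bar{o},11} & 0 & 0 & A_{\bar{c}\bar{o},12} \\ A_{co,21} & A_{13,2} & 0 & A_{co,22} & 0 & 0 \\ A_{21,1} & A_{23} & A_{24,1} & A_{21,2} & A_{c\bar{o}} & A_{24,2} \\ 0 & A_{43,2} & A_{\bar{c}\bar{o},21} & 0 & 0 & A_{\bar{c}\bar{o},22} \end{pmatrix}$, $\hat{B} = \begin{pmatrix} B_{co,1} \\ 0 \\ 0 \\ B_{co,2} \\ B_{c\bar{o}} \\ 0 \end{pmatrix}$, $\hat{C} = \begin{pmatrix} C_{co,1} & C_{\bar{c}o} & 0 & C_{co,2} & 0 & 0 \end{pmatrix}$.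
   Context: Setting: $x=\begin{pmatrix} q\\ p\end{pmatrix}$ with $q=(q_1,\dots,q_n)^\top$, $p=(p_1,\dots,p_n)^\top$ self-adjoint position/momentum operators satisfying the canonical commutation relations $[x,x^\top]=\imath\mathbb{J}_{2n}$, where $\mathbb{J}_{2k}=\begin{pmatrix} 0_{k\times k} & I_k\\ -I_k & 0_{k\times k}\end{pmatrix}$. $R$ is a real symmetric $2n\times 2n$ Hamiltonian matrix, $C$ a real $2m\times 2n$ coupling matrix, $\Sigma$ a real symplectic $2m\times 2m$ matrix, and $\mathcal{U},\mathcal{Y}$ are the $2m$-vectors of input and output field quadratures. For a $2r\times 2s$ matrix $X$, $X^{\sharp}=-\mathbb{J}_{2s}X^{\dagger}\mathbb{J}_{2r}$; a $2k\times 2k$ matrix $T$ is symplectic if $TT^{\sharp}=T^{\sharp}T=I_{2k}$. Only real symplectic state transformations preserve the structure of the system (self-adjointness and CCRs). With $A=\mathbb{J}_{2n}R-\tfrac12 C^\sharp C$, $B=-C^\sharp\Sigma$, the controllability matrix is $(B\ AB\ \cdots\ A^{2n-1}B)$ and the observability matrix is $(C; CA; \dots; CA^{2n-1})$; the controllable subspace is the image of the controllability matrix, the unobservable subspace is the kernel of the observability matrix, and the uncontrollable and observable subspaces are defined as the orthogonal complements in $\mathbb{R}^{2n}$ of the controllable and unobservable subspaces, respectively. *)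

theory Defs
  imports "Jordan_Normal_Form.Matrix"
begin

text \<open>Real matrices are Jordan_Normal_Form matrices of type real mat, with explicit
  dimensions. Indices are 0-based.\<close>

definition JJ :: "nat \<Rightarrow> real mat" where
  "JJ k = four_block_mat (0\<^sub>m k k) (1\<^sub>m k) (- 1\<^sub>m k) (0\<^sub>m k k)"

text \<open>For a 2r x 2s matrix X: X sharp = - J_{2s} X^dagger J_{2r} (real case: dagger = transpose).\<close>
definition sharp :: "real mat \<Rightarrow> real mat" where
  "sharp X = - (JJ (dim_col X div 2) * transpose_mat X * JJ (dim_row X div 2))"

definition symplectic :: "nat \<Rightarrow> real mat \<Rightarrow> bool" where
  "symplectic k T \<longleftrightarrow> T \<in> carrier_mat (2*k) (2*k)
      \<and> T * sharp T = 1\<^sub>m (2*k) \<and> sharp T * T = 1\<^sub>m (2*k)"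

text \<open>Controllability matrix (B AB ... A^(N-1) B) of an N x N matrix A and N x p matrix B.\<close>
definition ctrb_mat :: "real mat \<Rightarrow> real mat \<Rightarrow> real mat" where
  "ctrb_mat A B = (let N = dim_row A; p = dim_col B in
     mat N (N*p) (\<lambda>(i,j). ((A ^\<^sub>m (j div p)) * B) $$ (i, j mod p)))"

text \<open>Observability matrix (C; CA; ...; C A^(N-1)) of N x N matrix A and q x N matrix C.\<close>
definition obsv_mat :: "real mat \<Rightarrow> real mat \<Rightarrow> real mat" where
  "obsv_mat A C = (let N = dim_row A; q = dim_row C in
     mat (N*q) N (\<lambda>(i,j). (C * (A ^\<^sub>m (i div q))) $$ (i mod q, j)))"

definition controllable_subspace :: "real mat \<Rightarrow> real mat \<Rightarrow> real vec set" where
  "controllable_subspace A B =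
     {ctrb_mat A B *\<^sub>v u | u. u \<in> carrier_vec (dim_col (ctrb_mat A B))}"

definition unobservable_subspace :: "real mat \<Rightarrow> real mat \<Rightarrow> real vec set" where
  "unobservable_subspace A C =
     {x \<in> carrier_vec (dim_row A). obsv_mat A C *\<^sub>v x = 0\<^sub>v (dim_row (obsv_mat A C))}"

definition orth_compl :: "nat \<Rightarrow> real vec set \<Rightarrow> real vec set" where
  "orth_compl N S = {y \<in> carrier_vec N. \<forall>x\<in>S. y \<bullet> x = 0}"

definition uncontrollable_subspace :: "real mat \<Rightarrow> real mat \<Rightarrow> real vec set" where
  "uncontrollable_subspace A B = orth_compl (dim_row A) (controllable_subspace A B)"

definition observable_subspace :: "real mat \<Rightarrow> real mat \<Rightarrow> real vec set" where
  "observable_subspace A C = orth_compl (dim_row A) (unobservable_subspace A C)"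

text \<open>Span of the coordinate vectors e_i, i in S, inside R^N.\<close>
definition coord_span :: "nat \<Rightarrow> nat set \<Rightarrow> real vec set" where
  "coord_span N S = {x \<in> carrier_vec N. \<forall>i<N. i \<notin> S \<longrightarrow> x $ i = 0}"

text \<open>Block class of index i of xhat = (q_a,q_b,q_c,p_a,p_b,p_c) with sizes k,l,n-k-l:
  0 = q_a, 1 = q_b, 2 = q_c, 3 = p_a, 4 = p_b, 5 = p_c.\<close>
definition blk :: "nat \<Rightarrow> nat \<Rightarrow> nat \<Rightarrow> nat \<Rightarrow> nat" where
  "blk n k l i = (if i < n then (if i < k then 0 else if i < k + l then 1 else 2)
                  else (if i - n < k then 3 else if i - n < k + l then 4 else 5))"

definition idx_of :: "nat \<Rightarrow> nat \<Rightarrow> nat \<Rightarrow> nat set \<Rightarrow> nat set" where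
  "idx_of n k l S = {i. i < 2*n \<and> blk n k l i \<in> S}"

text \<open>Allowed (possibly nonzero) block positions of Ahat, row class r, column class c.\<close>
definition A_allowed :: "nat \<Rightarrow> nat \<Rightarrow> bool" where
  "A_allowed r c \<longleftrightarrow>
     (r = 0 \<and> c \<in> {0,1,3}) \<or> (r = 1 \<and> c = 1) \<or> (r = 2 \<and> c \<in> {1,2,5}) \<or>
     (r = 3 \<and> c \<in> {0,1,3}) \<or> r = 4 \<or> (r = 5 \<and> c \<in> {1,2,5})"

end

theory Submission
  imports Defs "Jordan_Normal_Form.Determinant"
begin

text \<open>The controllable subspace of the system is \<open>A\<close>-invariant and contains the range of \<open>B\<close>; the
  unobservable subspace is \<open>A\<close>-invariant and lies in \<open>ker C\<close>. The structure of the quantum system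
  ties the two together: the unobservable subspace is exactly the symplectic complement of the
  controllable one, because on \<open>ker C\<close> the dissipative part of \<open>A\<close> vanishes and \<open>J R\<close> is skew for
  \<open>\<omega>(x, y) = x\<^sup>T J y\<close>, while \<open>B = -C\<^sup>\<sharp> \<Sigma>\<close> pairs \<open>\<omega>(A\<^sup>j B u, x)\<close> with \<open>C A\<^sup>j x\<close> through the
  invertible \<open>J \<Sigma>\<close>.

  A symplectic Gram--Schmidt process, carried out with transvections, moves any subspace by a
  symplectic \<open>V\<close> onto the span of \<open>q\<^sub>1, \<dots>, q\<^sub>k, p\<^sub>1, \<dots>, p\<^sub>k\<^sub>+\<^sub>l\<close> (\<open>k\<close> hyperbolic pairs and \<open>l\<close>
  isotropic directions). Applied to the controllable subspace this gives the coordinates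
  \<open>(q\<^sub>a, p\<^sub>a, p\<^sub>b)\<close>; the symplectic complement is then the span of \<open>(p\<^sub>b, q\<^sub>c, p\<^sub>c)\<close>. All four
  intersections are coordinate spans, and the zero blocks of the transformed matrices express the
  invariance of the two subspaces together with \<open>ran B \<subseteq> controllable\<close> and
  \<open>unobservable \<subseteq> ker C\<close>.\<close>

section \<open>The standard symplectic form\<close>

definition Jvec :: "nat \<Rightarrow> real vec \<Rightarrow> real vec" where
  "Jvec n x = vec (2*n) (\<lambda>i. if i < n then x $ (i+n) else - (x $ (i-n)))"

lemma Jvec_carrier[simp]: "Jvec n x \<in> carrier_vec (2*n)" "dim_vec (Jvec n x) = 2*n"
  unfolding Jvec_def by auto

lemma index_Jvec[simp]:
  "i < 2*n \<Longrightarrow> Jvec n x $ i = (if i < n then x $ (i+n) else - (x $ (i-n)))"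
  unfolding Jvec_def by auto

lemma JJ_carrier[simp]: "JJ n \<in> carrier_mat (2*n) (2*n)"
  unfolding JJ_def by (metis four_block_carrier_mat mult_2 one_carrier_mat zero_carrier_mat)

lemma JJ_dims[simp]: "dim_row (JJ n) = 2*n" "dim_col (JJ n) = 2*n"
  using JJ_carrier[of n] unfolding carrier_mat_def by auto

lemma JJ_mult_vec: assumes "x \<in> carrier_vec (2*n)" shows "JJ n *\<^sub>v x = Jvec n x"
proof (rule eq_vecI)
  fix i assume "i < dim_vec (Jvec n x)"
  hence i: "i < 2*n" by simp
  have "row (JJ n) i = (if i < n then unit_vec (2*n) (i+n) else - unit_vec (2*n) (i-n))"
    using i by (intro eq_vecI) (auto simp: JJ_def index_mat_four_block unit_vec_def)
  thus "(JJ n *\<^sub>v x) $ i = Jvec n x $ i" using i assms by auto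
qed simp

lemma Jvec_Jvec: "x \<in> carrier_vec (2*n) \<Longrightarrow> Jvec n (Jvec n x) = - x"
  by (rule eq_vecI) auto

lemma Jvec_add:
  "x \<in> carrier_vec (2*n) \<Longrightarrow> y \<in> carrier_vec (2*n) \<Longrightarrow> Jvec n (x + y) = Jvec n x + Jvec n y"
  by (rule eq_vecI) auto

lemma Jvec_smult: "x \<in> carrier_vec (2*n) \<Longrightarrow> Jvec n (c \<cdot>\<^sub>v x) = c \<cdot>\<^sub>v Jvec n x"
  by (rule eq_vecI) auto

lemma Jvec_zero[simp]: "Jvec n (0\<^sub>v (2*n)) = 0\<^sub>v (2*n)"
  by (rule eq_vecI) auto

lemma Jvec_uminus: "x \<in> carrier_vec (2*n) \<Longrightarrow> Jvec n (- x) = - Jvec n x"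
  by (rule eq_vecI) auto

lemma scalar_prod_split_halves:
  fixes x y :: "real vec" assumes "x \<in> carrier_vec (2*n)" "y \<in> carrier_vec (2*n)"
  shows "x \<bullet> y = (\<Sum>i<n. x$i * y$i) + (\<Sum>i<n. x$(i+n) * y$(i+n))"
proof -
  have "x \<bullet> y = (\<Sum>i<2*n. x$i * y$i)"
    using assms by (simp add: scalar_prod_def lessThan_atLeast0)
  also have "\<dots> = (\<Sum>i<n. x$i * y$i) + (\<Sum>i\<in>{n..<2*n}. x$i * y$i)"
    by (simp add: lessThan_atLeast0 sum.atLeastLessThan_concat)
  also have "(\<Sum>i\<in>{n..<2*n}. x$i * y$i) = (\<Sum>i<n. x$(i+n) * y$(i+n))"
    using sum.shift_bounds_nat_ivl[of "\<lambda>i. x$i * y$i" 0 n n] by (simp add: mult_2 lessThan_atLeast0)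
  finally show ?thesis .
qed

lemma scalar_prod_Jvec_Jvec:
  assumes "a \<in> carrier_vec (2*n)" "b \<in> carrier_vec (2*n)" shows "Jvec n a \<bullet> Jvec n b = a \<bullet> b"
  using assms by (simp add: scalar_prod_split_halves[of _ n] add.commute)

lemma scalar_prod_Jvec_left:
  assumes "a \<in> carrier_vec (2*n)" "b \<in> carrier_vec (2*n)" shows "Jvec n a \<bullet> b = - (a \<bullet> Jvec n b)"
proof -
  have "Jvec n a \<bullet> b = (\<Sum>i<n. a$(i+n) * b$i) - (\<Sum>i<n. a$i * b$(i+n))"
    using assms by (simp add: scalar_prod_split_halves[of _ n] sum_negf)
  moreover have "a \<bullet> Jvec n b = (\<Sum>i<n. a$i * b$(i+n)) - (\<Sum>i<n. a$(i+n) * b$i)"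
    using assms by (simp add: scalar_prod_split_halves[of _ n] sum_negf)
  ultimately show ?thesis by simp
qed

text \<open>The form \<open>\<omega>(x, y) = x\<^sup>T J\<^sub>2\<^sub>n y\<close>, so that \<open>\<omega>(e\<^sub>q\<^sub>i, e\<^sub>p\<^sub>i) = 1\<close>.\<close>

definition symp_form :: "nat \<Rightarrow> real vec \<Rightarrow> real vec \<Rightarrow> real" where
  "symp_form n x y = x \<bullet> Jvec n y"

lemma symp_form_sum:
  assumes "x \<in> carrier_vec (2*n)" "y \<in> carrier_vec (2*n)"
  shows "symp_form n x y = (\<Sum>i<n. x$i * y$(i+n) - x$(i+n) * y$i)"
  using assms by (simp add: symp_form_def scalar_prod_split_halves[of _ n] sum_subtractf sum_negf)

lemma symp_form_antisym:
  "x \<in> carrier_vec (2*n) \<Longrightarrow> y \<in> carrier_vec (2*n) \<Longrightarrow> symp_form n x y = - symp_form n y x"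
  by (simp add: symp_form_sum sum_negf[symmetric] algebra_simps)

lemma symp_form_self[simp]: "x \<in> carrier_vec (2*n) \<Longrightarrow> symp_form n x x = 0"
  using symp_form_antisym[of x n x] by simp

lemma symp_form_add_left:
  "x \<in> carrier_vec (2*n) \<Longrightarrow> y \<in> carrier_vec (2*n) \<Longrightarrow> z \<in> carrier_vec (2*n) \<Longrightarrow>
   symp_form n (x + y) z = symp_form n x z + symp_form n y z"
  by (simp add: symp_form_def add_scalar_prod_distrib[of _ "2*n"])

lemma symp_form_add_right:
  "x \<in> carrier_vec (2*n) \<Longrightarrow> y \<in> carrier_vec (2*n) \<Longrightarrow> z \<in> carrier_vec (2*n) \<Longrightarrow>
   symp_form n x (y + z) = symp_form n x y + symp_form n x z"
  by (simp add: symp_form_def Jvec_add scalar_prod_add_distrib[of _ "2*n"])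

lemma symp_form_diff_left:
  "x \<in> carrier_vec (2*n) \<Longrightarrow> y \<in> carrier_vec (2*n) \<Longrightarrow> z \<in> carrier_vec (2*n) \<Longrightarrow>
   symp_form n (x - y) z = symp_form n x z - symp_form n y z"
  by (simp add: symp_form_def minus_scalar_prod_distrib[of _ "2*n"])

lemma symp_form_smult_left:
  "x \<in> carrier_vec (2*n) \<Longrightarrow> y \<in> carrier_vec (2*n) \<Longrightarrow> symp_form n (c \<cdot>\<^sub>v x) y = c * symp_form n x y"
  by (simp add: symp_form_def)

lemma symp_form_smult_right:
  "x \<in> carrier_vec (2*n) \<Longrightarrow> y \<in> carrier_vec (2*n) \<Longrightarrow> symp_form n x (c \<cdot>\<^sub>v y) = c * symp_form n x y"
  by (simp add: symp_form_def Jvec_smult)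

lemma symp_form_unit_vec:
  assumes "i < n" "y \<in> carrier_vec (2*n)"
  shows "symp_form n (unit_vec (2*n) i) y = y $ (i+n)"
    and "symp_form n (unit_vec (2*n) (i+n)) y = - y $ i"
  using assms by (auto simp: symp_form_def)

lemma symp_form_Jvec_right:
  assumes "x \<in> carrier_vec (2*n)" "y \<in> carrier_vec (2*n)" shows "symp_form n x (Jvec n y) = - (x \<bullet> y)"
  using assms by (simp add: symp_form_def Jvec_Jvec)

lemma scalar_prod_self_eq_0: fixes x :: "real vec"
  assumes x: "x \<in> carrier_vec N" and z: "x \<bullet> x = 0" shows "x = 0\<^sub>v N"
proof (rule eq_vecI)
  have "(\<Sum>i\<in>{0..<N}. x$i * x$i) = 0" using z x unfolding scalar_prod_def by simp
  hence "\<forall>i\<in>{0..<N}. x$i * x$i = 0" by (subst sum_nonneg_eq_0_iff[symmetric], auto)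
  thus "\<And>i. i < dim_vec (0\<^sub>v N) \<Longrightarrow> x $ i = 0\<^sub>v N $ i" by auto
qed (use x in auto)

section \<open>Symplectic matrices\<close>

lemma sharp_carrier: "G \<in> carrier_mat (2*m) (2*n) \<Longrightarrow> sharp G \<in> carrier_mat (2*n) (2*m)"
  unfolding sharp_def by auto

lemma sharp_mult_vec:
  assumes G: "G \<in> carrier_mat (2*m) (2*n)" and w: "w \<in> carrier_vec (2*m)"
  shows "sharp G *\<^sub>v w = - Jvec n (transpose_mat G *\<^sub>v Jvec m w)"
proof -
  have "(JJ n * transpose_mat G * JJ m) *\<^sub>v w = (JJ n * transpose_mat G) *\<^sub>v (JJ m *\<^sub>v w)"
    using G w by (intro assoc_mult_mat_vec[of _ "2*n" "2*m"]) auto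
  also have "\<dots> = JJ n *\<^sub>v (transpose_mat G *\<^sub>v (JJ m *\<^sub>v w))"
    using G w by (intro assoc_mult_mat_vec[of _ "2*n" "2*n" _ "2*m"]) (auto simp: JJ_mult_vec)
  also have "\<dots> = Jvec n (transpose_mat G *\<^sub>v Jvec m w)" using G w by (simp add: JJ_mult_vec)
  finally show ?thesis using G w unfolding sharp_def by simp
qed

lemma symplectic_carrier: "symplectic n T \<Longrightarrow> T \<in> carrier_mat (2*n) (2*n)"
  unfolding symplectic_def by auto

lemma symplectic_inverse:
  assumes "symplectic n T" "x \<in> carrier_vec (2*n)"
  shows "sharp T *\<^sub>v (T *\<^sub>v x) = x" "T *\<^sub>v (sharp T *\<^sub>v x) = x"
proof -
  have T: "T \<in> carrier_mat (2*n) (2*n)" using assms symplectic_carrier by auto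
  have "(sharp T * T) *\<^sub>v x = x" "(T * sharp T) *\<^sub>v x = x" using assms unfolding symplectic_def by auto
  thus "sharp T *\<^sub>v (T *\<^sub>v x) = x" "T *\<^sub>v (sharp T *\<^sub>v x) = x"
    using T assms(2) sharp_carrier[OF T] by auto
qed

lemma vec_eq_by_scalar_prod: fixes a b :: "real vec"
  assumes "a \<in> carrier_vec N" "b \<in> carrier_vec N" "\<And>x. x \<in> carrier_vec N \<Longrightarrow> x \<bullet> a = x \<bullet> b"
  shows "a = b"
proof (rule eq_vecI)
  fix i assume "i < dim_vec b"
  hence i: "i < N" using assms by auto
  show "a $ i = b $ i"
    using assms(3)[of "unit_vec N i"] scalar_prod_left_unit[OF assms(1) i] scalar_prod_left_unit[OF assms(2) i]
    by simp
qed (use assms in auto)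

lemma mult_mat_unit_vec:
  fixes M :: "real mat" assumes "M \<in> carrier_mat nr nc" "j < nc"
  shows "M *\<^sub>v unit_vec nc j = col M j"
  using assms by (intro eq_vecI) (auto simp: scalar_prod_right_unit)

lemma symplectic_iff_transpose_J:
  assumes T: "T \<in> carrier_mat (2*n) (2*n)"
  shows "symplectic n T \<longleftrightarrow> (\<forall>y\<in>carrier_vec (2*n). transpose_mat T *\<^sub>v Jvec n (T *\<^sub>v y) = Jvec n y)"
proof -
  have sharp_T: "sharp T *\<^sub>v (T *\<^sub>v y) = - Jvec n (transpose_mat T *\<^sub>v Jvec n (T *\<^sub>v y))"
    if "y \<in> carrier_vec (2*n)" for y
    using that T by (simp add: sharp_mult_vec)
  show ?thesis
  proof
    assume S: "symplectic n T"
    show "\<forall>y\<in>carrier_vec (2*n). transpose_mat T *\<^sub>v Jvec n (T *\<^sub>v y) = Jvec n y"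
    proof
      fix y :: "real vec" assume y: "y \<in> carrier_vec (2*n)"
      have "- Jvec n (transpose_mat T *\<^sub>v Jvec n (T *\<^sub>v y)) = y"
        using symplectic_inverse(1)[OF S y] sharp_T[OF y] by simp
      hence "Jvec n (- Jvec n (transpose_mat T *\<^sub>v Jvec n (T *\<^sub>v y))) = Jvec n y" by simp
      thus "transpose_mat T *\<^sub>v Jvec n (T *\<^sub>v y) = Jvec n y"
        using T by (simp add: Jvec_uminus Jvec_Jvec)
    qed
  next
    assume key: "\<forall>y\<in>carrier_vec (2*n). transpose_mat T *\<^sub>v Jvec n (T *\<^sub>v y) = Jvec n y"
    have ST: "sharp T * T = 1\<^sub>m (2*n)"
    proof (rule eq_matI)
      fix i j assume ij: "i < dim_row (1\<^sub>m (2*n))" "j < dim_col (1\<^sub>m (2*n))"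
      have e: "unit_vec (2*n) j \<in> carrier_vec (2*n)" by simp
      have "(sharp T * T) *\<^sub>v unit_vec (2*n) j = unit_vec (2*n) j"
        using T sharp_carrier[OF T] sharp_T[OF e] key e by (simp add: Jvec_Jvec)
      moreover have "(sharp T * T) $$ (i,j) = ((sharp T * T) *\<^sub>v unit_vec (2*n) j) $ i"
        using ij T sharp_carrier[OF T] by (subst mult_mat_unit_vec) auto
      ultimately show "(sharp T * T) $$ (i,j) = 1\<^sub>m (2*n) $$ (i,j)" using ij by simp
    qed (use T sharp_carrier[OF T] in auto)
    have "T * sharp T = 1\<^sub>m (2*n)"
      by (rule mat_mult_left_right_inverse[OF sharp_carrier[OF T] T ST])
    with ST T show "symplectic n T" unfolding symplectic_def by auto
  qed
qed

lemma symplectic_iff_preserves_symp_form: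
  assumes T: "T \<in> carrier_mat (2*n) (2*n)"
  shows "symplectic n T \<longleftrightarrow>
    (\<forall>x\<in>carrier_vec (2*n). \<forall>y\<in>carrier_vec (2*n). symp_form n (T *\<^sub>v x) (T *\<^sub>v y) = symp_form n x y)"
proof -
  have form: "symp_form n (T *\<^sub>v x) (T *\<^sub>v y) = x \<bullet> (transpose_mat T *\<^sub>v Jvec n (T *\<^sub>v y))"
    if "x \<in> carrier_vec (2*n)" "y \<in> carrier_vec (2*n)" for x y
  proof -
    have "x \<bullet> (transpose_mat T *\<^sub>v Jvec n (T *\<^sub>v y)) = (transpose_mat T *\<^sub>v Jvec n (T *\<^sub>v y)) \<bullet> x"
      using that T by (intro comm_scalar_prod[of _ "2*n"]) auto
    also have "\<dots> = Jvec n (T *\<^sub>v y) \<bullet> (T *\<^sub>v x)"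
      using that T by (intro transpose_vec_mult_scalar[OF T]) auto
    also have "\<dots> = symp_form n (T *\<^sub>v x) (T *\<^sub>v y)"
      unfolding symp_form_def using that T by (intro comm_scalar_prod[of _ "2*n"]) auto
    finally show ?thesis by simp
  qed
  show ?thesis
    unfolding symplectic_iff_transpose_J[OF T]
  proof (intro iffI ballI)
    fix x y :: "real vec" assume x: "x \<in> carrier_vec (2*n)" and y: "y \<in> carrier_vec (2*n)"
    assume "\<forall>y\<in>carrier_vec (2*n). transpose_mat T *\<^sub>v Jvec n (T *\<^sub>v y) = Jvec n y"
    thus "symp_form n (T *\<^sub>v x) (T *\<^sub>v y) = symp_form n x y"
      using form[OF x y] y by (simp add: symp_form_def)
  next
    fix y :: "real vec" assume y: "y \<in> carrier_vec (2*n)"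
    assume "\<forall>x\<in>carrier_vec (2*n). \<forall>y\<in>carrier_vec (2*n).
      symp_form n (T *\<^sub>v x) (T *\<^sub>v y) = symp_form n x y"
    thus "transpose_mat T *\<^sub>v Jvec n (T *\<^sub>v y) = Jvec n y"
      using T y form[OF _ y] by (intro vec_eq_by_scalar_prod[of _ "2*n"]) (auto simp: symp_form_def)
  qed
qed

lemma symplectic_preserves_symp_form:
  "symplectic n T \<Longrightarrow> x \<in> carrier_vec (2*n) \<Longrightarrow> y \<in> carrier_vec (2*n) \<Longrightarrow>
   symp_form n (T *\<^sub>v x) (T *\<^sub>v y) = symp_form n x y"
  using symplectic_iff_preserves_symp_form[OF symplectic_carrier] by blast

lemma symplectic_mult: assumes "symplectic n T1" "symplectic n T2" shows "symplectic n (T2 * T1)"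
proof -
  have c: "T1 \<in> carrier_mat (2*n) (2*n)" "T2 \<in> carrier_mat (2*n) (2*n)"
    using assms symplectic_carrier by auto
  show ?thesis using c assms
    by (subst symplectic_iff_preserves_symp_form) (auto simp: symplectic_preserves_symp_form)
qed

lemma symplectic_one: "symplectic n (1\<^sub>m (2*n))"
  by (subst symplectic_iff_preserves_symp_form) auto

section \<open>Symplectic transvections\<close>

text \<open>\<open>tail_vecs n j\<close> is the symplectic subspace spanned by the modes \<open>j, \<dots>, n-1\<close>, and
  \<open>head_vecs n j\<close> the one spanned by the modes \<open>0, \<dots>, j-1\<close>.\<close>

definition tail_vecs :: "nat \<Rightarrow> nat \<Rightarrow> real vec set" where
  "tail_vecs n j = {x \<in> carrier_vec (2*n). \<forall>i<n. i < j \<longrightarrow> x$i = 0 \<and> x$(i+n) = 0}"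

definition head_vecs :: "nat \<Rightarrow> nat \<Rightarrow> real vec set" where
  "head_vecs n j = {x \<in> carrier_vec (2*n). \<forall>i<n. j \<le> i \<longrightarrow> x$i = 0 \<and> x$(i+n) = 0}"

lemma tail_vecs_carrier: "x \<in> tail_vecs n j \<Longrightarrow> x \<in> carrier_vec (2*n)"
  unfolding tail_vecs_def by auto

lemma tail_vecs_closed:
  "x \<in> tail_vecs n j \<Longrightarrow> y \<in> tail_vecs n j \<Longrightarrow> x + y \<in> tail_vecs n j"
  "x \<in> tail_vecs n j \<Longrightarrow> y \<in> tail_vecs n j \<Longrightarrow> x - y \<in> tail_vecs n j"
  "x \<in> tail_vecs n j \<Longrightarrow> c \<cdot>\<^sub>v x \<in> tail_vecs n j"
  "x \<in> tail_vecs n j \<Longrightarrow> - x \<in> tail_vecs n j"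
  "x \<in> tail_vecs n j \<Longrightarrow> Jvec n x \<in> tail_vecs n j"
  unfolding tail_vecs_def by auto

lemma unit_vec_tail_vecs:
  "j \<le> i \<Longrightarrow> i < n \<Longrightarrow> unit_vec (2*n) i \<in> tail_vecs n j"
  "j \<le> i \<Longrightarrow> i < n \<Longrightarrow> unit_vec (2*n) (i+n) \<in> tail_vecs n j"
  unfolding tail_vecs_def by auto

lemma tail_vecs_Suc: "tail_vecs n (Suc j) \<subseteq> tail_vecs n j"
  unfolding tail_vecs_def by auto

lemma tail_vecs_trivial: assumes "x \<in> tail_vecs n j" "n \<le> j" shows "x = 0\<^sub>v (2*n)"
proof (rule eq_vecI)
  fix i assume "i < dim_vec (0\<^sub>v (2*n))"
  thus "x $ i = 0\<^sub>v (2*n) $ i"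
    using assms unfolding tail_vecs_def
    by (cases "i < n") (auto dest!: spec[of _ "i - n"])
qed (use assms in \<open>auto simp: tail_vecs_def\<close>)

lemma symp_form_tail_head: assumes "w \<in> tail_vecs n j" "x \<in> head_vecs n j"
  shows "symp_form n w x = 0"
proof -
  have "symp_form n w x = (\<Sum>i<n. w$i * x$(i+n) - w$(i+n) * x$i)"
    using assms by (intro symp_form_sum) (auto simp: tail_vecs_def head_vecs_def)
  also have "\<dots> = 0"
    using assms unfolding tail_vecs_def head_vecs_def by (intro sum.neutral) (auto simp: not_less)
  finally show ?thesis .
qed

definition acts_on_tail :: "nat \<Rightarrow> nat \<Rightarrow> real mat \<Rightarrow> bool" where
  "acts_on_tail n j T \<longleftrightarrow> symplectic n T \<and> (\<forall>x\<in>head_vecs n j. T *\<^sub>v x = x)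
     \<and> (\<forall>x\<in>tail_vecs n j. T *\<^sub>v x \<in> tail_vecs n j)"

lemma acts_on_tail_carrier: "acts_on_tail n j T \<Longrightarrow> T \<in> carrier_mat (2*n) (2*n)"
  unfolding acts_on_tail_def by (auto intro: symplectic_carrier)

lemma acts_on_tail_one: "acts_on_tail n j (1\<^sub>m (2*n))"
  unfolding acts_on_tail_def using symplectic_one by (auto simp: tail_vecs_def head_vecs_def)

lemma acts_on_tail_mult:
  assumes "acts_on_tail n j T1" "acts_on_tail n j T2" shows "acts_on_tail n j (T2 * T1)"
  using assms acts_on_tail_carrier[OF assms(1)] acts_on_tail_carrier[OF assms(2)]
  unfolding acts_on_tail_def by (auto simp: symplectic_mult tail_vecs_def head_vecs_def)

lemma acts_on_tail_fixes_unit_vec: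
  assumes "acts_on_tail n (Suc j) T" "j < n"
  shows "T *\<^sub>v unit_vec (2*n) j = unit_vec (2*n) j" "T *\<^sub>v unit_vec (2*n) (j+n) = unit_vec (2*n) (j+n)"
  using assms unfolding acts_on_tail_def head_vecs_def by auto

lemma unit_vec_decomposition:
  assumes "x \<in> carrier_vec (2*n)" "j < n"
  defines "y \<equiv> x - x$j \<cdot>\<^sub>v unit_vec (2*n) j - x$(j+n) \<cdot>\<^sub>v unit_vec (2*n) (j+n)"
  shows "x = x$j \<cdot>\<^sub>v unit_vec (2*n) j + x$(j+n) \<cdot>\<^sub>v unit_vec (2*n) (j+n) + y"
    and "x \<in> tail_vecs n j \<Longrightarrow> y \<in> tail_vecs n (Suc j)"
  using assms unfolding tail_vecs_def by (auto intro!: eq_vecI simp: less_Suc_eq)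

lemma acts_on_tail_Suc:
  assumes V: "acts_on_tail n (Suc j) V" and j: "j < n" shows "acts_on_tail n j V"
proof -
  have Vc: "V \<in> carrier_mat (2*n) (2*n)" using V by (rule acts_on_tail_carrier)
  have "V *\<^sub>v x \<in> tail_vecs n j" if x: "x \<in> tail_vecs n j" for x
  proof -
    have xc: "x \<in> carrier_vec (2*n)" using x by (rule tail_vecs_carrier)
    define e f :: "real vec" where "e = unit_vec (2*n) j" and "f = unit_vec (2*n) (j+n)"
    define y where "y = x - x$j \<cdot>\<^sub>v e - x$(j+n) \<cdot>\<^sub>v f"
    have y: "y \<in> tail_vecs n (Suc j)" and xy: "x = x$j \<cdot>\<^sub>v e + x$(j+n) \<cdot>\<^sub>v f + y"
      using unit_vec_decomposition[OF xc j] x unfolding y_def e_def f_def by auto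
    have yc: "y \<in> carrier_vec (2*n)" using y by (rule tail_vecs_carrier)
    have ef: "e \<in> carrier_vec (2*n)" "f \<in> carrier_vec (2*n)" unfolding e_def f_def by auto
    have "V *\<^sub>v x = V *\<^sub>v (x$j \<cdot>\<^sub>v e + x$(j+n) \<cdot>\<^sub>v f + y)" using xy by simp
    also have "\<dots> = x$j \<cdot>\<^sub>v (V *\<^sub>v e) + x$(j+n) \<cdot>\<^sub>v (V *\<^sub>v f) + V *\<^sub>v y"
      using Vc yc ef
      by (simp add: mult_add_distrib_mat_vec[of _ "2*n" "2*n"] mult_mat_vec[of _ "2*n" "2*n"] assoc_add_vec[of _ "2*n"])
    also have "\<dots> = x$j \<cdot>\<^sub>v e + x$(j+n) \<cdot>\<^sub>v f + V *\<^sub>v y"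
      using acts_on_tail_fixes_unit_vec[OF V j] unfolding e_def f_def by simp
    moreover have "V *\<^sub>v y \<in> tail_vecs n j"
      using V y tail_vecs_Suc unfolding acts_on_tail_def by blast
    ultimately show ?thesis
      using j unfolding e_def f_def by (auto intro!: tail_vecs_closed unit_vec_tail_vecs)
  qed
  thus ?thesis using V unfolding acts_on_tail_def head_vecs_def by auto
qed

definition transvection :: "nat \<Rightarrow> real vec \<Rightarrow> real \<Rightarrow> real mat" where
  "transvection n w c = mat (2*n) (2*n) (\<lambda>(a,b). (if a = b then 1 else 0) - c * w$a * Jvec n w $ b)"

lemma transvection_carrier: "transvection n w c \<in> carrier_mat (2*n) (2*n)"
  unfolding transvection_def by auto

lemma transvection_mult_vec:
  assumes w: "w \<in> carrier_vec (2*n)" and x: "x \<in> carrier_vec (2*n)"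
  shows "transvection n w c *\<^sub>v x = x + (c * symp_form n w x) \<cdot>\<^sub>v w"
proof (rule eq_vecI)
  fix a assume "a < dim_vec (x + (c * symp_form n w x) \<cdot>\<^sub>v w)"
  hence a: "a < 2*n" using x w by simp
  have "row (transvection n w c) a = unit_vec (2*n) a - (c * w$a) \<cdot>\<^sub>v Jvec n w"
    using a by (intro eq_vecI) (auto simp: transvection_def unit_vec_def)
  moreover have "(transvection n w c *\<^sub>v x) $ a = row (transvection n w c) a \<bullet> x"
    using a by (subst index_mult_mat_vec) (auto simp: transvection_def)
  ultimately have "(transvection n w c *\<^sub>v x) $ a = x $ a - (c * w$a) * (Jvec n w \<bullet> x)"
    using a x by (simp add: minus_scalar_prod_distrib[of _ "2*n"])
  thus "(transvection n w c *\<^sub>v x) $ a = (x + (c * symp_form n w x) \<cdot>\<^sub>v w) $ a"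
    using a x w by (simp add: scalar_prod_Jvec_left symp_form_def)
qed (use x w in \<open>auto simp: transvection_def\<close>)

lemma symplectic_transvection:
  assumes w: "w \<in> carrier_vec (2*n)" shows "symplectic n (transvection n w c)"
proof (subst symplectic_iff_preserves_symp_form[OF transvection_carrier], intro ballI)
  fix x y :: "real vec" assume x: "x \<in> carrier_vec (2*n)" and y: "y \<in> carrier_vec (2*n)"
  have "symp_form n (x + (c * symp_form n w x) \<cdot>\<^sub>v w) (y + (c * symp_form n w y) \<cdot>\<^sub>v w)
    = symp_form n x y + c * symp_form n w y * symp_form n x w + c * symp_form n w x * symp_form n w y"
    using x y w by (simp add: symp_form_add_left symp_form_add_right symp_form_smult_left symp_form_smult_right)
  also have "\<dots> = symp_form n x y" using symp_form_antisym[OF x w] by (simp add: algebra_simps)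
  finally show "symp_form n (transvection n w c *\<^sub>v x) (transvection n w c *\<^sub>v y) = symp_form n x y"
    using x y w by (simp add: transvection_mult_vec)
qed

lemma acts_on_tail_transvection:
  assumes w: "w \<in> tail_vecs n j" shows "acts_on_tail n j (transvection n w c)"
  unfolding acts_on_tail_def
proof (intro conjI ballI)
  have wc: "w \<in> carrier_vec (2*n)" using w by (rule tail_vecs_carrier)
  show "symplectic n (transvection n w c)" by (rule symplectic_transvection[OF wc])
  show "transvection n w c *\<^sub>v x = x" if "x \<in> head_vecs n j" for x
    using that symp_form_tail_head[OF w that] wc
    by (auto simp: transvection_mult_vec head_vecs_def intro!: eq_vecI)
  show "transvection n w c *\<^sub>v x \<in> tail_vecs n j" if "x \<in> tail_vecs n j" for x
    using that w wc tail_vecs_carrier[OF that] by (simp add: transvection_mult_vec tail_vecs_closed)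
qed

section \<open>Transitivity of the symplectic group\<close>

text \<open>The witness is the transvection along \<open>y - x\<close> with weight \<open>1 / \<omega>(y - x, x)\<close>.\<close>

lemma transvection_maps:
  assumes x: "x \<in> tail_vecs n j" and y: "y \<in> tail_vecs n j" and nz: "symp_form n x y \<noteq> 0"
  shows "\<exists>T. acts_on_tail n j T \<and> T *\<^sub>v x = y \<and>
    (\<forall>z\<in>carrier_vec (2*n). symp_form n (y - x) z = 0 \<longrightarrow> T *\<^sub>v z = z)"
proof -
  have xc: "x \<in> carrier_vec (2*n)" and yc: "y \<in> carrier_vec (2*n)"
    using x y tail_vecs_carrier by auto
  define w where "w = y - x"
  have w: "w \<in> tail_vecs n j" unfolding w_def by (rule tail_vecs_closed(2)[OF y x])
  have wc: "w \<in> carrier_vec (2*n)" using w by (rule tail_vecs_carrier)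
  have omw: "symp_form n w x = - symp_form n x y"
    unfolding w_def using xc yc symp_form_antisym[OF yc xc] by (simp add: symp_form_diff_left)
  define T where "T = transvection n w (1 / symp_form n w x)"
  have "T *\<^sub>v x = x + w"
    unfolding T_def using nz omw wc xc by (simp add: transvection_mult_vec)
  also have "x + w = y" unfolding w_def using xc yc by (auto intro!: eq_vecI)
  finally have "T *\<^sub>v x = y" .
  moreover have "T *\<^sub>v z = z" if "z \<in> carrier_vec (2*n)" "symp_form n w z = 0" for z
    unfolding T_def using that wc by (auto simp: transvection_mult_vec intro!: eq_vecI)
  ultimately show ?thesis using acts_on_tail_transvection[OF w] unfolding T_def w_def by blast
qed

lemma acts_on_tail_transitive:
  assumes x: "x \<in> tail_vecs n j" and y: "y \<in> tail_vecs n j"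
    and xnz: "x \<noteq> 0\<^sub>v (2*n)" and ynz: "y \<noteq> 0\<^sub>v (2*n)"
  shows "\<exists>T. acts_on_tail n j T \<and> T *\<^sub>v x = y"
proof (cases "symp_form n x y = 0")
  case False thus ?thesis using transvection_maps[OF x y] by blast
next
  case True
  have xc: "x \<in> carrier_vec (2*n)" and yc: "y \<in> carrier_vec (2*n)"
    using x y tail_vecs_carrier by auto
  have xx: "x \<bullet> x \<noteq> 0" and yy: "y \<bullet> y \<noteq> 0"
    using scalar_prod_self_eq_0 xc yc xnz ynz by blast+
  have left: "symp_form n x (- Jvec n v) = x \<bullet> v" and right: "symp_form n (- Jvec n v) y = - (v \<bullet> y)"
    if "v \<in> carrier_vec (2*n)" for v
    using that xc yc symp_form_Jvec_right[OF xc that]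
    by (simp_all add: symp_form_def Jvec_uminus scalar_prod_Jvec_Jvec)
  txt \<open>An intermediate vector \<open>z\<close> that is \<open>\<omega>\<close>-paired with both \<open>x\<close> and \<open>y\<close>.\<close>
  obtain z where z: "z \<in> tail_vecs n j" "symp_form n x z \<noteq> 0" "symp_form n z y \<noteq> 0"
  proof (cases "x \<bullet> y = 0")
    case False
    show ?thesis
      by (rule that[of "- Jvec n x"])
        (use x xc False xx in \<open>auto simp: left right tail_vecs_closed comm_scalar_prod[OF xc yc]\<close>)
  next
    case True
    have "symp_form n x (- Jvec n (x + y)) = x \<bullet> x" "symp_form n (- Jvec n (x + y)) y = - (y \<bullet> y)"
      using xc yc True comm_scalar_prod[OF xc yc]
      by (simp_all add: left right scalar_prod_add_distrib[of _ "2*n"] add_scalar_prod_distrib[of _ "2*n"])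
    thus ?thesis
      by (intro that[of "- Jvec n (x + y)"]) (use x y xx yy in \<open>auto simp: tail_vecs_closed\<close>)
  qed
  obtain T1 where T1: "acts_on_tail n j T1" "T1 *\<^sub>v x = z" using transvection_maps[OF x z(1,2)] by blast
  obtain T2 where T2: "acts_on_tail n j T2" "T2 *\<^sub>v z = y" using transvection_maps[OF z(1) y z(3)] by blast
  have "(T2 * T1) *\<^sub>v x = y"
    using T1 T2 xc acts_on_tail_carrier[OF T1(1)] acts_on_tail_carrier[OF T2(1)] by auto
  thus ?thesis using acts_on_tail_mult[OF T1(1) T2(1)] by blast
qed

lemma acts_on_tail_partner:
  assumes j: "j < n" and v: "v \<in> tail_vecs n j" and o1: "symp_form n (unit_vec (2*n) j) v = 1"
  shows "\<exists>T. acts_on_tail n j T \<and> T *\<^sub>v unit_vec (2*n) j = unit_vec (2*n) j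
    \<and> T *\<^sub>v v = unit_vec (2*n) (j+n)"
proof -
  define e f :: "real vec" where "e = unit_vec (2*n) j" and "f = unit_vec (2*n) (j+n)"
  have ec: "e \<in> carrier_vec (2*n)" "f \<in> carrier_vec (2*n)" unfolding e_def f_def by auto
  have et: "e \<in> tail_vecs n j" and ft: "f \<in> tail_vecs n j"
    unfolding e_def f_def using j by (auto intro: unit_vec_tail_vecs)
  have oef: "symp_form n e f = 1" unfolding e_def f_def using j by (simp add: symp_form_unit_vec)
  have move: "\<exists>T. acts_on_tail n j T \<and> T *\<^sub>v e = e \<and> T *\<^sub>v v1 = v2"
    if v1: "v1 \<in> tail_vecs n j" and v2: "v2 \<in> tail_vecs n j" and "symp_form n e v1 = 1"
      and "symp_form n e v2 = 1" and nz: "symp_form n v1 v2 \<noteq> 0" for v1 v2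
  proof -
    have vc: "v1 \<in> carrier_vec (2*n)" "v2 \<in> carrier_vec (2*n)" using v1 v2 tail_vecs_carrier by auto
    obtain T where T: "acts_on_tail n j T" "T *\<^sub>v v1 = v2"
      "\<forall>z\<in>carrier_vec (2*n). symp_form n (v2 - v1) z = 0 \<longrightarrow> T *\<^sub>v z = z"
      using transvection_maps[OF v1 v2 nz] by blast
    have "symp_form n (v2 - v1) e = 0"
      using vc ec that(3,4) symp_form_antisym[OF vc(1) ec(1)] symp_form_antisym[OF vc(2) ec(1)]
      by (simp add: symp_form_diff_left)
    thus ?thesis using T ec by blast
  qed
  have vc: "v \<in> carrier_vec (2*n)" using v by (rule tail_vecs_carrier)
  show ?thesis
  proof (cases "symp_form n v f = 0")
    case False thus ?thesis using move[OF v ft o1[folded e_def] oef] unfolding e_def f_def by blast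
  next
    case True
    txt \<open>Pass through \<open>e + f\<close>, which is \<open>\<omega>\<close>-paired with both \<open>v\<close> and \<open>f\<close>.\<close>
    have z: "e + f \<in> tail_vecs n j" using et ft by (rule tail_vecs_closed)
    have oez: "symp_form n e (e + f) = 1" using ec oef by (simp add: symp_form_add_right)
    have "symp_form n v (e + f) = -1"
      using True o1 vc ec symp_form_antisym[OF vc ec(1)] unfolding e_def[symmetric]
      by (simp add: symp_form_add_right)
    hence ovz: "symp_form n v (e + f) \<noteq> 0" by simp
    have ozf: "symp_form n (e + f) f \<noteq> 0" using ec oef by (simp add: symp_form_add_left)
    obtain T1 where T1: "acts_on_tail n j T1" "T1 *\<^sub>v e = e" "T1 *\<^sub>v v = e + f"
      using move[OF v z o1[folded e_def] oez ovz] by blast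
    obtain T2 where T2: "acts_on_tail n j T2" "T2 *\<^sub>v e = e" "T2 *\<^sub>v (e + f) = f"
      using move[OF z ft oez oef ozf] by blast
    have "(T2 * T1) *\<^sub>v e = e" "(T2 * T1) *\<^sub>v v = f"
      using T1 T2 vc ec acts_on_tail_carrier[OF T1(1)] acts_on_tail_carrier[OF T2(1)] by auto
    thus ?thesis using acts_on_tail_mult[OF T1(1) T2(1)] unfolding e_def f_def by blast
  qed
qed

lemma acts_on_tail_hyperbolic_pair:
  assumes u: "u \<in> tail_vecs n j" and v: "v \<in> tail_vecs n j" and o1: "symp_form n u v = 1"
  shows "j < n \<and> (\<exists>T. acts_on_tail n j T \<and> T *\<^sub>v u = unit_vec (2*n) j \<and> T *\<^sub>v v = unit_vec (2*n) (j+n))"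
proof -
  have uc: "u \<in> carrier_vec (2*n)" and vc: "v \<in> carrier_vec (2*n)"
    using u v tail_vecs_carrier by auto
  have unz: "u \<noteq> 0\<^sub>v (2*n)" using o1 vc by (auto simp: symp_form_def)
  have j: "j < n" using tail_vecs_trivial[OF u] unz by force
  have e: "unit_vec (2*n) j \<in> tail_vecs n j" using j by (rule unit_vec_tail_vecs[OF le_refl])
  have enz: "unit_vec (2*n) j \<noteq> 0\<^sub>v (2*n)" using j by simp
  obtain T1 where T1: "acts_on_tail n j T1" "T1 *\<^sub>v u = unit_vec (2*n) j"
    using acts_on_tail_transitive[OF u e unz enz] by blast
  have c1: "T1 \<in> carrier_mat (2*n) (2*n)" "symplectic n T1"
    using T1(1) acts_on_tail_carrier unfolding acts_on_tail_def by auto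
  have v1: "T1 *\<^sub>v v \<in> tail_vecs n j" using T1 v unfolding acts_on_tail_def by auto
  have "symp_form n (unit_vec (2*n) j) (T1 *\<^sub>v v) = 1"
    using symplectic_preserves_symp_form[OF c1(2) uc vc] T1 o1 by simp
  then obtain T2 where T2: "acts_on_tail n j T2" "T2 *\<^sub>v unit_vec (2*n) j = unit_vec (2*n) j"
      "T2 *\<^sub>v (T1 *\<^sub>v v) = unit_vec (2*n) (j+n)"
    using acts_on_tail_partner[OF j v1] by blast
  have "(T2 * T1) *\<^sub>v u = unit_vec (2*n) j" "(T2 * T1) *\<^sub>v v = unit_vec (2*n) (j+n)"
    using c1 acts_on_tail_carrier[OF T2(1)] T1 T2 uc vc by auto
  thus ?thesis using acts_on_tail_mult[OF T1(1) T2(1)] j by blast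
qed

section \<open>Symplectic normal form of a subspace\<close>

definition vec_subspace :: "nat \<Rightarrow> real vec set \<Rightarrow> bool" where
  "vec_subspace N S \<longleftrightarrow> S \<subseteq> carrier_vec N \<and> 0\<^sub>v N \<in> S
     \<and> (\<forall>x\<in>S. \<forall>y\<in>S. x + y \<in> S) \<and> (\<forall>c. \<forall>x\<in>S. c \<cdot>\<^sub>v x \<in> S)"

lemma vec_subspaceD:
  assumes "vec_subspace N S"
  shows "S \<subseteq> carrier_vec N" "0\<^sub>v N \<in> S" "x \<in> S \<Longrightarrow> y \<in> S \<Longrightarrow> x + y \<in> S"
    "x \<in> S \<Longrightarrow> c \<cdot>\<^sub>v x \<in> S"
  using assms unfolding vec_subspace_def by blast+

lemma vec_subspace_diff:
  assumes S: "vec_subspace N S" and "x \<in> S" "y \<in> S" shows "x - y \<in> S"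
proof -
  have "x - y = x + (-1) \<cdot>\<^sub>v y"
    using assms vec_subspaceD(1)[OF S] by (auto intro!: eq_vecI)
  thus ?thesis using assms by (simp add: vec_subspaceD)
qed

lemma vec_subspace_carrier_vec: "vec_subspace N (carrier_vec N)"
  unfolding vec_subspace_def by auto

lemma vec_subspace_image:
  assumes T: "T \<in> carrier_mat N M" and S: "vec_subspace M S"
  shows "vec_subspace N ((*\<^sub>v) T ` S)"
proof -
  have Sc: "S \<subseteq> carrier_vec M" using S by (rule vec_subspaceD)
  have "T *\<^sub>v x + T *\<^sub>v y = T *\<^sub>v (x + y)" "c \<cdot>\<^sub>v (T *\<^sub>v x) = T *\<^sub>v (c \<cdot>\<^sub>v x)"
    if "x \<in> S" "y \<in> S" for x y c
    using that subsetD[OF Sc] T by (auto simp: mult_add_distrib_mat_vec[of _ N M] mult_mat_vec[of _ N M])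
  moreover have "T *\<^sub>v 0\<^sub>v M = 0\<^sub>v N" using T by auto
  ultimately show ?thesis
    using T Sc vec_subspaceD[OF S] unfolding vec_subspace_def by (auto intro!: image_eqI)
qed

lemma vec_subspace_Int_tail_vecs:
  "vec_subspace (2*n) S \<Longrightarrow> vec_subspace (2*n) (S \<inter> tail_vecs n j)"
  unfolding vec_subspace_def by (auto simp: tail_vecs_closed) (auto simp: tail_vecs_def)

definition isotropic :: "nat \<Rightarrow> real vec set \<Rightarrow> bool" where
  "isotropic n S \<longleftrightarrow> (\<forall>x\<in>S. \<forall>y\<in>S. symp_form n x y = 0)"

lemma isotropic_image_iff:
  assumes "symplectic n T" "S \<subseteq> carrier_vec (2*n)"
  shows "isotropic n ((*\<^sub>v) T ` S) \<longleftrightarrow> isotropic n S"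
  using assms symplectic_preserves_symp_form unfolding isotropic_def by (auto simp: subset_iff)

text \<open>The coordinates \<open>q\<^sub>j, \<dots>, q\<^sub>j\<^sub>+\<^sub>k\<^sub>-\<^sub>1\<close> and \<open>p\<^sub>j, \<dots>, p\<^sub>j\<^sub>+\<^sub>k\<^sub>+\<^sub>l\<^sub>-\<^sub>1\<close>.\<close>

definition normal_form_idx :: "nat \<Rightarrow> nat \<Rightarrow> nat \<Rightarrow> nat \<Rightarrow> nat set" where
  "normal_form_idx n j k l = {i. (j \<le> i \<and> i < j+k) \<or> (j+n \<le> i \<and> i < j+n+k+l)}"

lemma coord_span_empty: "coord_span N {} = {0\<^sub>v N}"
  unfolding coord_span_def by (auto intro!: eq_vecI)

lemma unit_vec_coord_span: "j < N \<Longrightarrow> j \<in> I \<Longrightarrow> unit_vec N j \<in> coord_span N I"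
  unfolding coord_span_def by auto

lemma coord_span_index_zero: "x \<in> coord_span N I \<Longrightarrow> i < N \<Longrightarrow> i \<notin> I \<Longrightarrow> x $ i = 0"
  unfolding coord_span_def by auto

text \<open>One step of the normal form: once \<open>S\<close> has been moved so that \<open>e\<^sub>p \<in> S\<close> for the positions
  \<open>p \<in> P \<subseteq> {q\<^sub>j, p\<^sub>j}\<close> and \<open>S\<close> has no component along the others, a map that puts the part of
  \<open>S\<close> in the later modes into normal form and fixes mode \<open>j\<close> puts all of \<open>S\<close> into normal form.\<close>

lemma image_eq_coord_span_step:
  assumes j: "j < n" and S: "vec_subspace (2*n) S" "S \<subseteq> tail_vecs n j"
    and P: "P \<subseteq> {j, j+n}" "\<And>p. p \<in> P \<Longrightarrow> unit_vec (2*n) p \<in> S"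
      "\<And>x p. x \<in> S \<Longrightarrow> p \<in> {j, j+n} - P \<Longrightarrow> x $ p = 0"
    and V: "acts_on_tail n (Suc j) V" "(*\<^sub>v) V ` (S \<inter> tail_vecs n (Suc j)) = coord_span (2*n) I"
      "j \<notin> I" "j + n \<notin> I"
  shows "(*\<^sub>v) V ` S = coord_span (2*n) (P \<union> I)"
proof -
  have Vc: "V \<in> carrier_mat (2*n) (2*n)" using V(1) by (rule acts_on_tail_carrier)
  define e f :: "real vec" where "e = unit_vec (2*n) j" and "f = unit_vec (2*n) (j+n)"
  have ef: "e \<in> carrier_vec (2*n)" "f \<in> carrier_vec (2*n)" unfolding e_def f_def by auto
  have fix_ef: "V *\<^sub>v e = e" "V *\<^sub>v f = f"
    using acts_on_tail_fixes_unit_vec[OF V(1) j] unfolding e_def f_def by auto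
  have lin: "V *\<^sub>v (a \<cdot>\<^sub>v e + b \<cdot>\<^sub>v f + y) = a \<cdot>\<^sub>v e + b \<cdot>\<^sub>v f + V *\<^sub>v y"
    if "y \<in> carrier_vec (2*n)" for a b y
    using that Vc ef fix_ef
    by (simp add: mult_add_distrib_mat_vec[of _ "2*n" "2*n"] mult_mat_vec[of _ "2*n" "2*n"])
  txt \<open>For \<open>x\<close> in \<open>S\<close> or in the target span, the components along \<open>e\<close>, \<open>f\<close> are multiples of
    vectors of \<open>S\<close>, so they can be split off.\<close>
  have comp_in_S: "x $ j \<cdot>\<^sub>v e \<in> S \<and> x $ (j+n) \<cdot>\<^sub>v f \<in> S"
    if x0: "\<And>p. p \<in> {j, j+n} - P \<Longrightarrow> x $ p = 0" for x
  proof -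
    have "x $ p \<cdot>\<^sub>v unit_vec (2*n) p \<in> S" if "p \<in> {j, j+n}" for p
    proof (cases "p \<in> P")
      case True thus ?thesis using P(2) vec_subspaceD(4)[OF S(1)] by blast
    next
      case False
      hence "x $ p \<cdot>\<^sub>v unit_vec (2*n) p = 0\<^sub>v (2*n)" using x0 that by (auto intro!: eq_vecI)
      thus ?thesis using vec_subspaceD(2)[OF S(1)] by simp
    qed
    thus ?thesis unfolding e_def f_def by blast
  qed
  show ?thesis
  proof (intro equalityI subsetI)
    fix z assume "z \<in> (*\<^sub>v) V ` S"
    then obtain x where x: "x \<in> S" and z: "z = V *\<^sub>v x" by blast
    have xc: "x \<in> carrier_vec (2*n)" using x S(1) vec_subspaceD(1) by blast
    define y where "y = x - x$j \<cdot>\<^sub>v e - x$(j+n) \<cdot>\<^sub>v f"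
    have yS: "y \<in> S" unfolding y_def
      using comp_in_S[of x] P(3)[OF x] x by (auto intro!: vec_subspace_diff[OF S(1)])
    moreover have "y \<in> tail_vecs n (Suc j)"
      using unit_vec_decomposition(2)[OF xc j] x S(2) unfolding y_def e_def f_def by auto
    ultimately have Vy: "V *\<^sub>v y \<in> coord_span (2*n) I" using V(2) by blast
    have yc: "y \<in> carrier_vec (2*n)" using yS S(1) vec_subspaceD(1) by blast
    have "z = x$j \<cdot>\<^sub>v e + x$(j+n) \<cdot>\<^sub>v f + V *\<^sub>v y"
      unfolding z using unit_vec_decomposition(1)[OF xc j] lin[OF yc] unfolding y_def e_def f_def
      by metis
    thus "z \<in> coord_span (2*n) (P \<union> I)"
      using Vy P(3)[OF x] Vc yc j unfolding coord_span_def e_def f_def by auto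
  next
    fix z assume z: "z \<in> coord_span (2*n) (P \<union> I)"
    have zc: "z \<in> carrier_vec (2*n)" using z unfolding coord_span_def by auto
    have zP: "z $ p = 0" if "p \<in> {j, j+n} - P" for p
      using coord_span_index_zero[OF z] that V(3,4) j by auto
    define y' where "y' = z - z$j \<cdot>\<^sub>v e - z$(j+n) \<cdot>\<^sub>v f"
    have "y' \<in> coord_span (2*n) I"
      using z P(1) j unfolding y'_def e_def f_def coord_span_def by (auto simp: unit_vec_def)
    then obtain y where y: "y \<in> S" "y \<in> tail_vecs n (Suc j)" and y': "y' = V *\<^sub>v y"
      using V(2) by (metis (no_types, lifting) IntE imageE)
    have yc: "y \<in> carrier_vec (2*n)" using y S(1) vec_subspaceD(1) by blast
    define x where "x = z$j \<cdot>\<^sub>v e + z$(j+n) \<cdot>\<^sub>v f + y"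
    have "x \<in> S" unfolding x_def using comp_in_S[of z] zP y(1) by (simp add: vec_subspaceD(3)[OF S(1)])
    moreover have "z = V *\<^sub>v x"
      unfolding x_def lin[OF yc] y'[symmetric] y'_def using zc ef by (auto intro!: eq_vecI)
    ultimately show "z \<in> (*\<^sub>v) V ` S" by blast
  qed
qed

lemma normal_form_idx_Suc:
  assumes "j < n" "Suc j + k + l \<le> n"
  shows "{j, j+n} \<union> normal_form_idx n (Suc j) k l = normal_form_idx n j (Suc k) l"
    and "{j+n} \<union> normal_form_idx n (Suc j) 0 l = normal_form_idx n j 0 (Suc l)"
    and "j \<notin> normal_form_idx n (Suc j) k l" "j + n \<notin> normal_form_idx n (Suc j) k l"
  using assms unfolding normal_form_idx_def by auto

text \<open>A nonzero subspace contains the second vector of a pair with \<open>\<omega>(u, v) = 1\<close>, and the first one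
  as well unless it is isotropic (then take \<open>u = J v / |v|\<^sup>2\<close>).\<close>

lemma obtain_symp_pair:
  assumes S: "vec_subspace (2*n) S" "S \<subseteq> tail_vecs n j" and nz: "v0 \<in> S" "v0 \<noteq> 0\<^sub>v (2*n)"
  obtains u v where "u \<in> tail_vecs n j" "v \<in> S" "symp_form n u v = 1" "\<not> isotropic n S \<Longrightarrow> u \<in> S"
proof (cases "isotropic n S")
  case True
  have vt: "v0 \<in> tail_vecs n j" and vc: "v0 \<in> carrier_vec (2*n)"
    using nz S tail_vecs_carrier by auto
  have vv: "v0 \<bullet> v0 \<noteq> 0" using scalar_prod_self_eq_0[OF vc] nz by blast
  have "symp_form n ((1 / (v0 \<bullet> v0)) \<cdot>\<^sub>v Jvec n v0) v0 = 1"
    using vc vv by (simp add: symp_form_def scalar_prod_Jvec_Jvec)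
  moreover have "(1 / (v0 \<bullet> v0)) \<cdot>\<^sub>v Jvec n v0 \<in> tail_vecs n j"
    using vt by (intro tail_vecs_closed)
  ultimately show ?thesis using nz(1) True by (intro that) auto
next
  case False
  then obtain u v where uv: "u \<in> S" "v \<in> S" "symp_form n u v \<noteq> 0" unfolding isotropic_def by blast
  have "u \<in> carrier_vec (2*n)" "v \<in> carrier_vec (2*n)" using uv S vec_subspaceD(1) by blast+
  hence "symp_form n u ((1 / symp_form n u v) \<cdot>\<^sub>v v) = 1" using uv by (simp add: symp_form_smult_right)
  moreover have "(1 / symp_form n u v) \<cdot>\<^sub>v v \<in> S" using uv(2) by (rule vec_subspaceD(4)[OF S(1)])
  ultimately show ?thesis using uv(1) S(2) by (intro that[of u]) auto
qed

lemma move_first_mode: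
  assumes S: "vec_subspace (2*n) S" "S \<subseteq> tail_vecs n j" and nz: "\<not> S \<subseteq> {0\<^sub>v (2*n)}"
  obtains T where "j < n" "acts_on_tail n j T"
    "isotropic n ((*\<^sub>v) T ` S) \<longleftrightarrow> isotropic n S"
    "unit_vec (2*n) (j+n) \<in> (*\<^sub>v) T ` S" "\<not> isotropic n S \<Longrightarrow> unit_vec (2*n) j \<in> (*\<^sub>v) T ` S"
    "\<And>x. isotropic n S \<Longrightarrow> x \<in> (*\<^sub>v) T ` S \<Longrightarrow> x $ j = 0"
proof -
  obtain v0 where v0: "v0 \<in> S" "v0 \<noteq> 0\<^sub>v (2*n)" using nz by blast
  obtain u v where uv: "u \<in> tail_vecs n j" "v \<in> S" "symp_form n u v = 1"
    "\<not> isotropic n S \<Longrightarrow> u \<in> S"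
    using obtain_symp_pair[OF S v0] by blast
  obtain T where j: "j < n" and T: "acts_on_tail n j T" "T *\<^sub>v u = unit_vec (2*n) j"
    "T *\<^sub>v v = unit_vec (2*n) (j+n)"
    using acts_on_tail_hyperbolic_pair[OF uv(1) _ uv(3)] uv(2) S(2) by blast
  have Sc: "S \<subseteq> carrier_vec (2*n)" using S(1) by (rule vec_subspaceD)
  have iso: "isotropic n ((*\<^sub>v) T ` S) \<longleftrightarrow> isotropic n S"
    using isotropic_image_iff T(1) Sc by (auto simp: acts_on_tail_def)
  have f: "unit_vec (2*n) (j+n) \<in> (*\<^sub>v) T ` S" and "\<not> isotropic n S \<Longrightarrow> unit_vec (2*n) j \<in> (*\<^sub>v) T ` S"
    using T(2,3) uv(2,4) by (metis image_eqI)+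
  moreover have "x $ j = 0" if "isotropic n S" "x \<in> (*\<^sub>v) T ` S" for x
  proof -
    have "x \<in> carrier_vec (2*n)" using that(2) Sc acts_on_tail_carrier[OF T(1)] by auto
    thus ?thesis using that f iso symp_form_unit_vec(2)[OF j, of x] unfolding isotropic_def by force
  qed
  ultimately show ?thesis using that j T(1) iso by blast
qed

lemma subspace_normal_form_tail:
  "j \<le> n \<Longrightarrow> vec_subspace (2*n) S \<Longrightarrow> S \<subseteq> tail_vecs n j \<Longrightarrow>
   \<exists>V k l. acts_on_tail n j V \<and> j + k + l \<le> n \<and>
     (*\<^sub>v) V ` S = coord_span (2*n) (normal_form_idx n j k l) \<and> (isotropic n S \<longrightarrow> k = 0)"
proof (induction "n - j" arbitrary: j S rule: less_induct)
  case less
  note S = less.prems(2,3)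
  have Sc: "S \<subseteq> carrier_vec (2*n)" using S(1) by (rule vec_subspaceD)
  show ?case
  proof (cases "S \<subseteq> {0\<^sub>v (2*n)}")
    case True
    hence "S = {0\<^sub>v (2*n)}" using vec_subspaceD(2)[OF S(1)] by blast
    moreover have "normal_form_idx n j 0 0 = {}" by (simp add: normal_form_idx_def)
    ultimately have "(*\<^sub>v) (1\<^sub>m (2*n)) ` S = coord_span (2*n) (normal_form_idx n j 0 0)"
      by (simp add: coord_span_empty)
    thus ?thesis using acts_on_tail_one less.prems(1)
      by (intro exI[of _ "1\<^sub>m (2*n)"] exI[of _ 0]) simp
  next
    case False
    then obtain T where j: "j < n" and T: "acts_on_tail n j T"
      and iso: "isotropic n ((*\<^sub>v) T ` S) \<longleftrightarrow> isotropic n S"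
      and f: "unit_vec (2*n) (j+n) \<in> (*\<^sub>v) T ` S" and e: "\<not> isotropic n S \<Longrightarrow> unit_vec (2*n) j \<in> (*\<^sub>v) T ` S"
      and q0: "\<And>x. isotropic n S \<Longrightarrow> x \<in> (*\<^sub>v) T ` S \<Longrightarrow> x $ j = 0"
      using move_first_mode[OF S False] by blast
    have Tc: "T \<in> carrier_mat (2*n) (2*n)" using T by (rule acts_on_tail_carrier)
    define S' where "S' = (*\<^sub>v) T ` S"
    have S': "vec_subspace (2*n) S'" "S' \<subseteq> tail_vecs n j"
      unfolding S'_def using vec_subspace_image[OF Tc S(1)] T S(2) by (auto simp: acts_on_tail_def)
    define P where "P = (if isotropic n S then {j+n} else {j, j+n})"
    have P: "P \<subseteq> {j, j+n}" "\<And>p. p \<in> P \<Longrightarrow> unit_vec (2*n) p \<in> S'"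
      "\<And>x p. x \<in> S' \<Longrightarrow> p \<in> {j, j+n} - P \<Longrightarrow> x $ p = 0"
      using e f q0 unfolding P_def S'_def by (auto split: if_splits)
    define S'' where "S'' = S' \<inter> tail_vecs n (Suc j)"
    have "n - Suc j < n - j" "Suc j \<le> n" using j by auto
    from less.hyps[OF this, of S''] vec_subspace_Int_tail_vecs[OF S'(1)]
    obtain V k l where V: "acts_on_tail n (Suc j) V" "Suc j + k + l \<le> n"
      "(*\<^sub>v) V ` S'' = coord_span (2*n) (normal_form_idx n (Suc j) k l)" "isotropic n S'' \<longrightarrow> k = 0"
      unfolding S''_def by blast
    have Vc: "V \<in> carrier_mat (2*n) (2*n)" using V(1) by (rule acts_on_tail_carrier)
    have VT: "acts_on_tail n j (V * T)"
      by (rule acts_on_tail_mult[OF T acts_on_tail_Suc[OF V(1) j]])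
    have "(*\<^sub>v) (V * T) ` S = (*\<^sub>v) V ` S'"
      unfolding S'_def image_image using Sc Vc Tc by (auto intro!: image_cong)
    also have "\<dots> = coord_span (2*n) (P \<union> normal_form_idx n (Suc j) k l)"
      by (rule image_eq_coord_span_step[OF j S' P V(1) V(3)[unfolded S''_def]])
        (use normal_form_idx_Suc(3,4)[OF j V(2)] in auto)
    finally have img: "(*\<^sub>v) (V * T) ` S = coord_span (2*n) (P \<union> normal_form_idx n (Suc j) k l)" .
    show ?thesis
    proof (cases "isotropic n S")
      case True
      hence "k = 0" using V(4) iso unfolding S'_def S''_def isotropic_def by blast
      thus ?thesis using VT V(2) img True normal_form_idx_Suc(2)[OF j V(2)] unfolding P_def
        by (intro exI[of _ "V * T"] exI[of _ 0] exI[of _ "Suc l"]) simp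
    next
      case False
      thus ?thesis using VT V(2) img normal_form_idx_Suc(1)[OF j V(2)] unfolding P_def
        by (intro exI[of _ "V * T"] exI[of _ "Suc k"] exI[of _ l]) simp
    qed
  qed
qed

section \<open>Controllable and unobservable subspaces\<close>

fun vsum :: "nat \<Rightarrow> (nat \<Rightarrow> real vec) \<Rightarrow> nat \<Rightarrow> real vec" where
  "vsum N f 0 = 0\<^sub>v N"
| "vsum N f (Suc k) = vsum N f k + f k"

lemma vsum_carrier: "(\<And>i. i < k \<Longrightarrow> f i \<in> carrier_vec N) \<Longrightarrow> vsum N f k \<in> carrier_vec N"
  by (induction k) auto

lemma index_vsum:
  "(\<And>i. i < k \<Longrightarrow> f i \<in> carrier_vec N) \<Longrightarrow> r < N \<Longrightarrow> vsum N f k $ r = (\<Sum>i<k. f i $ r)"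
proof (induction k)
  case (Suc k)
  have "r < dim_vec (f k)" using Suc.prems(1)[of k] Suc.prems(2) by (metis carrier_vecD lessI)
  thus ?case using Suc by (simp only: vsum.simps, subst index_add_vec(1)) auto
qed simp

lemma mult_mat_vec_vsum:
  assumes A: "A \<in> carrier_mat M N" and f: "\<And>i. i < k \<Longrightarrow> f i \<in> carrier_vec N"
  shows "A *\<^sub>v vsum N f k = vsum M (\<lambda>i. A *\<^sub>v f i) k"
  using f
proof (induction k)
  case (Suc k)
  have "vsum N f k \<in> carrier_vec N" "f k \<in> carrier_vec N" using Suc.prems by (auto intro: vsum_carrier)
  thus ?case using Suc A by (simp add: mult_add_distrib_mat_vec[OF A])
qed (use A in auto)

lemma vsum_in_subspace:
  "vec_subspace N S \<Longrightarrow> (\<And>i. i < k \<Longrightarrow> f i \<in> S) \<Longrightarrow> vsum N f k \<in> S"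
  by (induction k) (auto simp: vec_subspaceD(2,3))

lemma mult_mat_vec_eq_vsum_cols:
  assumes M: "M \<in> carrier_mat N p" and u: "u \<in> carrier_vec p"
  shows "M *\<^sub>v u = vsum N (\<lambda>i. u $ i \<cdot>\<^sub>v col M i) p"
proof (rule eq_vecI)
  have colc: "col M i \<in> carrier_vec N" for i using M unfolding carrier_vec_def by simp
  have vc: "vsum N (\<lambda>i. u $ i \<cdot>\<^sub>v col M i) p \<in> carrier_vec N" by (rule vsum_carrier) (use colc in auto)
  show "dim_vec (M *\<^sub>v u) = dim_vec (vsum N (\<lambda>i. u $ i \<cdot>\<^sub>v col M i) p)" using vc M by simp
  fix r assume "r < dim_vec (vsum N (\<lambda>i. u $ i \<cdot>\<^sub>v col M i) p)"
  hence r: "r < N" using vc by simp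
  have "vsum N (\<lambda>i. u $ i \<cdot>\<^sub>v col M i) p $ r = (\<Sum>i<p. M $$ (r, i) * u $ i)"
    using colc r M by (subst index_vsum) (auto intro!: sum.cong)
  also have "\<dots> = (M *\<^sub>v u) $ r"
    using M r u by (simp add: scalar_prod_def lessThan_atLeast0 mult.commute)
  finally show "(M *\<^sub>v u) $ r = vsum N (\<lambda>i. u $ i \<cdot>\<^sub>v col M i) p $ r" by simp
qed

lemma mult_mat_vec_in_subspace:
  assumes S: "vec_subspace N S" and M: "M \<in> carrier_mat N p" and u: "u \<in> carrier_vec p"
    and cols: "\<And>i. i < p \<Longrightarrow> col M i \<in> S"
  shows "M *\<^sub>v u \<in> S"
  unfolding mult_mat_vec_eq_vsum_cols[OF M u]
  by (rule vsum_in_subspace[OF S]) (use cols vec_subspaceD(4)[OF S] in blast)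

lemma pow_mat_add:
  assumes A: "A \<in> carrier_mat N N" shows "A ^\<^sub>m (i + j) = A ^\<^sub>m i * A ^\<^sub>m j"
proof (induction j)
  case (Suc j)
  thus ?case using A by (simp add: assoc_mult_mat[of _ N N _ N _ N])
qed (use A in simp)

lemma pow_mat_mult_vec_add:
  assumes A: "A \<in> carrier_mat N N" and b: "b \<in> carrier_vec N"
  shows "A ^\<^sub>m (i + j) *\<^sub>v b = A ^\<^sub>m i *\<^sub>v (A ^\<^sub>m j *\<^sub>v b)"
  using A b by (simp add: pow_mat_add[OF A] assoc_mult_mat_vec[of _ N N _ N])

lemma pow_mat_mult_vec_carrier[simp]:
  "A \<in> carrier_mat N N \<Longrightarrow> b \<in> carrier_vec N \<Longrightarrow> A ^\<^sub>m k *\<^sub>v b \<in> carrier_vec N"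
  by (metis mult_mat_vec_carrier pow_carrier_mat)

lemma pow_mat_Suc_mult_vec:
  assumes A: "A \<in> carrier_mat N N" and b: "b \<in> carrier_vec N"
  shows "A ^\<^sub>m Suc j *\<^sub>v b = A *\<^sub>v (A ^\<^sub>m j *\<^sub>v b)"
  using pow_mat_mult_vec_add[OF A b, of 1 j] A by simp

lemma exists_vanishing_combination:
  fixes f :: "nat \<Rightarrow> real vec"
  assumes f: "\<And>i. i \<le> N \<Longrightarrow> f i \<in> carrier_vec N"
  shows "\<exists>c. (\<exists>i\<le>N. c i \<noteq> 0) \<and> (\<forall>r<N. (\<Sum>i<Suc N. c i * f i $ r) = 0)"
proof -
  define M where "M = mat\<^sub>r (Suc N) (Suc N) (\<lambda>r. if r = N then 0\<^sub>v (Suc N) else vec (Suc N) (\<lambda>i. f i $ r))"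
  have Mc: "M \<in> carrier_mat (Suc N) (Suc N)" unfolding M_def by simp
  have "det M = 0" unfolding M_def by (rule det_row_0) auto
  then obtain v where v: "v \<in> carrier_vec (Suc N)" "v \<noteq> 0\<^sub>v (Suc N)" "M *\<^sub>v v = 0\<^sub>v (Suc N)"
    using det_0_iff_vec_prod_zero_field[OF Mc] by blast
  have "\<exists>i\<le>N. v $ i \<noteq> 0"
  proof (rule ccontr)
    assume "\<not> ?thesis"
    hence "v = 0\<^sub>v (Suc N)" using v(1) by (intro eq_vecI) (auto simp: less_Suc_eq_le)
    thus False using v(2) by simp
  qed
  moreover have "(\<Sum>i<Suc N. v $ i * f i $ r) = 0" if r: "r < N" for r
  proof -
    have "(M *\<^sub>v v) $ r = (\<Sum>i<Suc N. f i $ r * v $ i)"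
      using r v(1) unfolding M_def by (simp add: scalar_prod_def lessThan_atLeast0)
    thus ?thesis using v(3) r by (simp add: mult.commute)
  qed
  ultimately show ?thesis by blast
qed

text \<open>A discrete Cayley--Hamilton argument: the \<open>N + 1\<close> vectors \<open>A\<^sup>i b\<close>, \<open>i \<le> N\<close>, are linearly
  dependent; solving the dependence for its highest term \<open>A\<^sup>d b\<close> and multiplying by \<open>A\<^sup>N\<^sup>-\<^sup>d\<close>
  writes \<open>A\<^sup>N b\<close> as a combination of lower powers.\<close>

lemma pow_mat_mult_vec_in_subspace:
  assumes S: "vec_subspace N S" and A: "A \<in> carrier_mat N N" and b: "b \<in> carrier_vec N"
    and lower: "\<And>i. i < N \<Longrightarrow> A ^\<^sub>m i *\<^sub>v b \<in> S"
  shows "A ^\<^sub>m N *\<^sub>v b \<in> S"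
proof -
  define f where "f i = A ^\<^sub>m i *\<^sub>v b" for i
  have fc: "f i \<in> carrier_vec N" for i unfolding f_def using A b by simp
  obtain c where c: "\<exists>i\<le>N. c i \<noteq> 0" "\<forall>r<N. (\<Sum>i<Suc N. c i * f i $ r) = 0"
    using exists_vanishing_combination[of N f] fc by blast
  define D where "D = {i. i \<le> N \<and> c i \<noteq> 0}"
  have "finite D" "D \<noteq> {}" unfolding D_def using c(1) by auto
  define d where "d = Max D"
  have "d \<in> D" unfolding d_def using \<open>finite D\<close> \<open>D \<noteq> {}\<close> by (rule Max_in)
  hence dN: "d \<le> N" and cd: "c d \<noteq> 0" unfolding D_def by auto
  have above: "c i = 0" if "d < i" "i \<le> N" for i
    using that Max_ge[OF \<open>finite D\<close>, of i] unfolding d_def D_def by fastforce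
  define a where "a i = - c i / c d" for i
  have fd: "f d = vsum N (\<lambda>i. a i \<cdot>\<^sub>v f i) d"
  proof (rule eq_vecI)
    have vc: "vsum N (\<lambda>i. a i \<cdot>\<^sub>v f i) d \<in> carrier_vec N" using fc by (intro vsum_carrier) auto
    thus "dim_vec (f d) = dim_vec (vsum N (\<lambda>i. a i \<cdot>\<^sub>v f i) d)" using fc[of d] by simp
    fix r assume "r < dim_vec (vsum N (\<lambda>i. a i \<cdot>\<^sub>v f i) d)"
    hence r: "r < N" using vc by simp
    have "(\<Sum>i<Suc N. c i * f i $ r) = (\<Sum>i<Suc d. c i * f i $ r)"
      by (rule sum.mono_neutral_right) (use dN above in auto)
    hence "c d * f d $ r = - (\<Sum>i<d. c i * f i $ r)" using c(2) r by simp
    hence "f d $ r = - (\<Sum>i<d. c i * f i $ r) / c d" using cd by (simp add: field_simps)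
    also have "\<dots> = (\<Sum>i<d. a i * f i $ r)" unfolding a_def by (simp add: sum_divide_distrib sum_negf)
    also have "\<dots> = vsum N (\<lambda>i. a i \<cdot>\<^sub>v f i) d $ r"
      using fc r by (subst index_vsum) (auto intro!: sum.cong simp: carrier_vecD[OF fc])
    finally show "f d $ r = vsum N (\<lambda>i. a i \<cdot>\<^sub>v f i) d $ r" .
  qed
  have AN: "A ^\<^sub>m (N - d) \<in> carrier_mat N N" using A by simp
  have "A ^\<^sub>m N *\<^sub>v b = A ^\<^sub>m (N - d) *\<^sub>v f d"
    unfolding f_def using pow_mat_mult_vec_add[OF A b, of "N - d" d] dN by simp
  also have "\<dots> = vsum N (\<lambda>i. A ^\<^sub>m (N - d) *\<^sub>v (a i \<cdot>\<^sub>v f i)) d"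
    unfolding fd by (rule mult_mat_vec_vsum[OF AN]) (use fc in auto)
  also have "\<dots> = vsum N (\<lambda>i. a i \<cdot>\<^sub>v (A ^\<^sub>m (N - d + i) *\<^sub>v b)) d"
    using mult_mat_vec[OF AN fc] pow_mat_mult_vec_add[OF A b, of "N - d"] unfolding f_def by simp
  also have "\<dots> \<in> S"
    using dN lower by (intro vsum_in_subspace[OF S] vec_subspaceD(4)[OF S]) auto
  finally show ?thesis .
qed

lemma block_index_less: fixes j r N q :: nat assumes "j < N" "r < q" shows "j * q + r < N * q"
proof -
  have "j * q + r < Suc j * q" using assms(2) by simp
  also have "\<dots> \<le> N * q" using assms(1) by (intro mult_right_mono) auto
  finally show ?thesis .
qed

lemma ctrb_mat_carrier:
  "A \<in> carrier_mat N N \<Longrightarrow> B \<in> carrier_mat N p \<Longrightarrow> ctrb_mat A B \<in> carrier_mat N (N*p)"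
  unfolding ctrb_mat_def Let_def by auto

lemma col_ctrb_mat:
  assumes A: "A \<in> carrier_mat N N" and B: "B \<in> carrier_mat N p" and i: "i < N*p"
  shows "col (ctrb_mat A B) i = A ^\<^sub>m (i div p) *\<^sub>v col B (i mod p)"
proof -
  have "i mod p < p" using i by (cases p) auto
  thus ?thesis using A B i by (intro eq_vecI) (auto simp: ctrb_mat_def Let_def)
qed

lemma controllable_subspace_eq_range:
  assumes A: "A \<in> carrier_mat N N" and B: "B \<in> carrier_mat N p"
  shows "controllable_subspace A B = (*\<^sub>v) (ctrb_mat A B) ` carrier_vec (N*p)"
  using ctrb_mat_carrier[OF A B] unfolding controllable_subspace_def by auto

lemma vec_subspace_controllable_subspace:
  assumes A: "A \<in> carrier_mat N N" and B: "B \<in> carrier_mat N p"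
  shows "vec_subspace N (controllable_subspace A B)"
  unfolding controllable_subspace_eq_range[OF A B]
  by (rule vec_subspace_image[OF ctrb_mat_carrier[OF A B] vec_subspace_carrier_vec])

lemma pow_mult_col_in_controllable_subspace:
  assumes A: "A \<in> carrier_mat N N" and B: "B \<in> carrier_mat N p" and j: "j < N" and c: "c < p"
  shows "A ^\<^sub>m j *\<^sub>v col B c \<in> controllable_subspace A B"
proof -
  have K: "ctrb_mat A B \<in> carrier_mat N (N*p)" by (rule ctrb_mat_carrier[OF A B])
  have i: "j * p + c < N * p" using j c by (rule block_index_less)
  have "ctrb_mat A B *\<^sub>v unit_vec (N*p) (j*p+c) = col (ctrb_mat A B) (j*p+c)"
    using K i by (intro eq_vecI) (auto simp: scalar_prod_right_unit)
  also have "\<dots> = A ^\<^sub>m j *\<^sub>v col B c" using col_ctrb_mat[OF A B i] c by simp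
  finally have "ctrb_mat A B *\<^sub>v unit_vec (N*p) (j*p+c) = A ^\<^sub>m j *\<^sub>v col B c" .
  moreover have "unit_vec (N*p) (j*p+c) \<in> carrier_vec (dim_col (ctrb_mat A B))" using K by simp
  ultimately show ?thesis unfolding controllable_subspace_def by (metis (mono_tags, lifting) mem_Collect_eq)
qed

lemma controllable_subspace_least:
  assumes A: "A \<in> carrier_mat N N" and B: "B \<in> carrier_mat N p" and S: "vec_subspace N S"
    and gen: "\<And>j c. j < N \<Longrightarrow> c < p \<Longrightarrow> A ^\<^sub>m j *\<^sub>v col B c \<in> S"
  shows "controllable_subspace A B \<subseteq> S"
proof
  have K: "ctrb_mat A B \<in> carrier_mat N (N*p)" by (rule ctrb_mat_carrier[OF A B])
  fix x assume "x \<in> controllable_subspace A B"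
  then obtain u where u: "u \<in> carrier_vec (N*p)" and x: "x = ctrb_mat A B *\<^sub>v u"
    unfolding controllable_subspace_def using K by auto
  have "col (ctrb_mat A B) i \<in> S" if "i < N*p" for i
  proof -
    have "0 < p" using that by (cases p) auto
    hence "i div p < N" "i mod p < p" using that by (auto simp: div_less_iff_less_mult)
    thus ?thesis using gen col_ctrb_mat[OF A B that] by simp
  qed
  thus "x \<in> S" unfolding x by (rule mult_mat_vec_in_subspace[OF S K u])
qed

lemma controllable_subspace_invariant:
  assumes A: "A \<in> carrier_mat N N" and B: "B \<in> carrier_mat N p"
    and x: "x \<in> controllable_subspace A B"
  shows "A *\<^sub>v x \<in> controllable_subspace A B"
proof -
  let ?C = "controllable_subspace A B"
  have Cs: "vec_subspace N ?C" by (rule vec_subspace_controllable_subspace[OF A B])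
  define S where "S = {y \<in> carrier_vec N. A *\<^sub>v y \<in> ?C}"
  have "A *\<^sub>v 0\<^sub>v N = 0\<^sub>v N" using A by auto
  hence S: "vec_subspace N S"
    unfolding vec_subspace_def S_def using A vec_subspaceD[OF Cs]
    by (auto simp: mult_add_distrib_mat_vec[OF A] mult_mat_vec[OF A])
  have "?C \<subseteq> S"
  proof (rule controllable_subspace_least[OF A B S])
    fix j c assume j: "j < N" and c: "c < p"
    have bc: "col B c \<in> carrier_vec N" using B c by simp
    have "A ^\<^sub>m Suc j *\<^sub>v col B c \<in> ?C"
    proof (cases "Suc j < N")
      case True thus ?thesis using pow_mult_col_in_controllable_subspace[OF A B _ c] by blast
    next
      case False
      hence "Suc j = N" using j by simp
      thus ?thesis
        using pow_mat_mult_vec_in_subspace[OF Cs A bc] pow_mult_col_in_controllable_subspace[OF A B _ c]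
        by blast
    qed
    thus "A ^\<^sub>m j *\<^sub>v col B c \<in> S"
      unfolding S_def pow_mat_Suc_mult_vec[OF A bc] using A bc by simp
  qed
  thus ?thesis using x unfolding S_def by auto
qed

lemma unobservable_subspace_iff:
  assumes A: "A \<in> carrier_mat N N" and C: "C \<in> carrier_mat q N"
  shows "x \<in> unobservable_subspace A C \<longleftrightarrow>
    x \<in> carrier_vec N \<and> (\<forall>j<N. C *\<^sub>v (A ^\<^sub>m j *\<^sub>v x) = 0\<^sub>v q)"
proof -
  let ?O = "obsv_mat A C"
  have O: "?O \<in> carrier_mat (N*q) N" using A C unfolding obsv_mat_def Let_def by auto
  have entry: "(?O *\<^sub>v x) $ i = (C *\<^sub>v (A ^\<^sub>m (i div q) *\<^sub>v x)) $ (i mod q)"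
    if x: "x \<in> carrier_vec N" and i: "i < N*q" for x i
  proof -
    have q: "0 < q" using i by (cases q) auto
    have Aj: "A ^\<^sub>m (i div q) \<in> carrier_mat N N" using A by simp
    have CAj: "C * A ^\<^sub>m (i div q) \<in> carrier_mat q N" using C Aj by simp
    have "?O $$ (i, c) = (C * A ^\<^sub>m (i div q)) $$ (i mod q, c)" if "c < N" for c
      using i that A C unfolding obsv_mat_def Let_def by (simp add: carrier_matD)
    moreover have "dim_vec (row (C * A ^\<^sub>m (i div q)) (i mod q)) = N"
      using CAj by (metis carrier_matD(2) index_row(2))
    ultimately have "row ?O i = row (C * A ^\<^sub>m (i div q)) (i mod q)"
      using i CAj q O by (intro eq_vecI) auto
    hence "(?O *\<^sub>v x) $ i = ((C * A ^\<^sub>m (i div q)) *\<^sub>v x) $ (i mod q)"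
      using O i CAj q by (simp del: index_mult_mat)
    also have "(C * A ^\<^sub>m (i div q)) *\<^sub>v x = C *\<^sub>v (A ^\<^sub>m (i div q) *\<^sub>v x)"
      using C Aj x by simp
    finally show ?thesis .
  qed
  have "(?O *\<^sub>v x = 0\<^sub>v (N*q)) \<longleftrightarrow> (\<forall>j<N. C *\<^sub>v (A ^\<^sub>m j *\<^sub>v x) = 0\<^sub>v q)"
    if x: "x \<in> carrier_vec N" for x
  proof
    assume z: "?O *\<^sub>v x = 0\<^sub>v (N*q)"
    show "\<forall>j<N. C *\<^sub>v (A ^\<^sub>m j *\<^sub>v x) = 0\<^sub>v q"
    proof (intro allI impI eq_vecI)
      fix j r assume j: "j < N" and "r < dim_vec (0\<^sub>v q)"
      hence r: "r < q" by simp
      have i: "j * q + r < N * q" using j r by (rule block_index_less)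
      show "(C *\<^sub>v (A ^\<^sub>m j *\<^sub>v x)) $ r = 0\<^sub>v q $ r"
        using entry[OF x i] z i r by simp
    qed (use C in simp)
  next
    assume H: "\<forall>j<N. C *\<^sub>v (A ^\<^sub>m j *\<^sub>v x) = 0\<^sub>v q"
    show "?O *\<^sub>v x = 0\<^sub>v (N*q)"
    proof (rule eq_vecI)
      fix i assume "i < dim_vec (0\<^sub>v (N*q))"
      hence i: "i < N*q" by simp
      hence "0 < q" by (cases q) auto
      hence "i div q < N" "i mod q < q" using i by (auto simp: div_less_iff_less_mult)
      thus "(?O *\<^sub>v x) $ i = 0\<^sub>v (N*q) $ i" using entry[OF x i] H i by simp
    qed (use O in simp)
  qed
  thus ?thesis unfolding unobservable_subspace_def using A O by auto
qed

lemma unobservable_subspace_invariant: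
  assumes A: "A \<in> carrier_mat N N" and C: "C \<in> carrier_mat q N"
    and x: "x \<in> unobservable_subspace A C"
  shows "A *\<^sub>v x \<in> unobservable_subspace A C"
proof -
  have xc: "x \<in> carrier_vec N" and Z: "\<And>j. j < N \<Longrightarrow> C *\<^sub>v (A ^\<^sub>m j *\<^sub>v x) = 0\<^sub>v q"
    using x unobservable_subspace_iff[OF A C] by auto
  define K where "K = {y \<in> carrier_vec N. C *\<^sub>v y = 0\<^sub>v q}"
  have K: "vec_subspace N K"
    unfolding vec_subspace_def K_def using C by (auto simp: mult_add_distrib_mat_vec[OF C] mult_mat_vec[OF C])
  have "A ^\<^sub>m j *\<^sub>v x \<in> K" if "j < N" for j unfolding K_def using Z[OF that] A xc by simp
  hence "A ^\<^sub>m Suc j *\<^sub>v x \<in> K" if "j < N" for j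
    using that pow_mat_mult_vec_in_subspace[OF K A xc] by (metis Suc_lessI)
  moreover have "A ^\<^sub>m Suc j *\<^sub>v x = A ^\<^sub>m j *\<^sub>v (A *\<^sub>v x)" for j
    using pow_mat_mult_vec_add[OF A xc, of j 1] A by simp
  ultimately have "A ^\<^sub>m j *\<^sub>v (A *\<^sub>v x) \<in> K" if "j < N" for j using that by metis
  hence "C *\<^sub>v (A ^\<^sub>m j *\<^sub>v (A *\<^sub>v x)) = 0\<^sub>v q" if "j < N" for j
    using that unfolding K_def by blast
  thus ?thesis unfolding unobservable_subspace_iff[OF A C] using A xc by simp
qed

lemma pow_mat_similar_mult_vec:
  assumes V: "V \<in> carrier_mat N N" and W: "W \<in> carrier_mat N N" and VW: "V * W = 1\<^sub>m N"
    and WV: "W * V = 1\<^sub>m N" and A: "A \<in> carrier_mat N N" and x: "x \<in> carrier_vec N"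
  shows "(V * A * W) ^\<^sub>m j *\<^sub>v x = V *\<^sub>v (A ^\<^sub>m j *\<^sub>v (W *\<^sub>v x))"
  using x
proof (induction j arbitrary: x)
  case 0
  have "V *\<^sub>v (W *\<^sub>v x) = x" using V W VW 0 by (simp flip: assoc_mult_mat_vec[of _ N N _ N])
  thus ?case using V A W 0 by simp
next
  case (Suc j x)
  have VAW: "V * A * W \<in> carrier_mat N N" using V A W by simp
  have Wx: "W *\<^sub>v x \<in> carrier_vec N" using W Suc.prems by simp
  have step: "(V * A * W) *\<^sub>v x = V *\<^sub>v (A *\<^sub>v (W *\<^sub>v x))"
    using V A W Suc.prems by (simp add: assoc_mult_mat_vec[of _ N N _ N])
  have WVy: "W *\<^sub>v (V *\<^sub>v y) = y" if "y \<in> carrier_vec N" for y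
    using V W WV that by (simp flip: assoc_mult_mat_vec[of _ N N _ N])
  have "(V * A * W) ^\<^sub>m Suc j *\<^sub>v x = (V * A * W) ^\<^sub>m j *\<^sub>v ((V * A * W) *\<^sub>v x)"
    using pow_mat_mult_vec_add[OF VAW Suc.prems, of j 1] VAW by simp
  also have "\<dots> = V *\<^sub>v (A ^\<^sub>m j *\<^sub>v (A *\<^sub>v (W *\<^sub>v x)))"
    unfolding step using Suc.IH[of "V *\<^sub>v (A *\<^sub>v (W *\<^sub>v x))"] V A Wx WVy by simp
  also have "A ^\<^sub>m j *\<^sub>v (A *\<^sub>v (W *\<^sub>v x)) = A ^\<^sub>m Suc j *\<^sub>v (W *\<^sub>v x)"
    using pow_mat_mult_vec_add[OF A Wx, of j 1] A by simp
  finally show ?case .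
qed

lemma controllable_subspace_similar:
  assumes V: "V \<in> carrier_mat N N" and W: "W \<in> carrier_mat N N" and VW: "V * W = 1\<^sub>m N"
    and WV: "W * V = 1\<^sub>m N" and A: "A \<in> carrier_mat N N" and B: "B \<in> carrier_mat N p"
  shows "controllable_subspace (V * A * W) (V * B) = (*\<^sub>v) V ` controllable_subspace A B"
proof -
  have Ah: "V * A * W \<in> carrier_mat N N" and Bh: "V * B \<in> carrier_mat N p" using V A W B by auto
  have gen: "(V * A * W) ^\<^sub>m j *\<^sub>v col (V * B) c = V *\<^sub>v (A ^\<^sub>m j *\<^sub>v col B c)" if c: "c < p" for j c
  proof -
    have bc: "col B c \<in> carrier_vec N" using B c by simp
    have "W *\<^sub>v (V *\<^sub>v col B c) = col B c"
      using V W WV bc by (simp flip: assoc_mult_mat_vec[of _ N N _ N])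
    moreover have "col (V * B) c = V *\<^sub>v col B c" by (rule col_mult2[OF V B c])
    ultimately show ?thesis using pow_mat_similar_mult_vec[OF V W VW WV A, of "V *\<^sub>v col B c" j] V bc
      by simp
  qed
  have S: "vec_subspace N (controllable_subspace A B)"
    by (rule vec_subspace_controllable_subspace[OF A B])
  have Sh: "vec_subspace N (controllable_subspace (V * A * W) (V * B))"
    by (rule vec_subspace_controllable_subspace[OF Ah Bh])
  show ?thesis
  proof
    show "controllable_subspace (V * A * W) (V * B) \<subseteq> (*\<^sub>v) V ` controllable_subspace A B"
      by (rule controllable_subspace_least[OF Ah Bh vec_subspace_image[OF V S]])
        (use gen pow_mult_col_in_controllable_subspace[OF A B] in auto)
  next
    define P where "P = {y \<in> carrier_vec N. V *\<^sub>v y \<in> controllable_subspace (V * A * W) (V * B)}"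
    have "V *\<^sub>v 0\<^sub>v N = 0\<^sub>v N" using V by auto
    hence Ps: "vec_subspace N P"
      unfolding vec_subspace_def P_def using vec_subspaceD[OF Sh] V
      by (auto simp: mult_add_distrib_mat_vec[OF V] mult_mat_vec[OF V])
    have "controllable_subspace A B \<subseteq> P"
      by (rule controllable_subspace_least[OF A B Ps])
        (use B gen pow_mult_col_in_controllable_subspace[OF Ah Bh] A in \<open>auto simp: P_def\<close>)
    thus "(*\<^sub>v) V ` controllable_subspace A B \<subseteq> controllable_subspace (V * A * W) (V * B)"
      unfolding P_def by auto
  qed
qed

lemma unobservable_subspace_similar:
  assumes V: "V \<in> carrier_mat N N" and W: "W \<in> carrier_mat N N" and VW: "V * W = 1\<^sub>m N"
    and WV: "W * V = 1\<^sub>m N" and A: "A \<in> carrier_mat N N" and C: "C \<in> carrier_mat q N"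
  shows "unobservable_subspace (V * A * W) (C * W) = (*\<^sub>v) V ` unobservable_subspace A C"
proof -
  have Ah: "V * A * W \<in> carrier_mat N N" and Ch: "C * W \<in> carrier_mat q N" using V A W C by auto
  have WVy: "W *\<^sub>v (V *\<^sub>v y) = y" and VWy: "V *\<^sub>v (W *\<^sub>v y) = y" if "y \<in> carrier_vec N" for y
    using V W WV VW that by (simp_all flip: assoc_mult_mat_vec[of _ N N _ N])
  have "(C * W) *\<^sub>v ((V * A * W) ^\<^sub>m j *\<^sub>v x) = C *\<^sub>v (A ^\<^sub>m j *\<^sub>v (W *\<^sub>v x))"
    if x: "x \<in> carrier_vec N" for j x
  proof -
    have y: "A ^\<^sub>m j *\<^sub>v (W *\<^sub>v x) \<in> carrier_vec N" using A W x by simp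
    have "(C * W) *\<^sub>v (V *\<^sub>v (A ^\<^sub>m j *\<^sub>v (W *\<^sub>v x))) = C *\<^sub>v (W *\<^sub>v (V *\<^sub>v (A ^\<^sub>m j *\<^sub>v (W *\<^sub>v x))))"
      using C W V y by (intro assoc_mult_mat_vec[of _ q N _ N]) auto
    thus ?thesis using pow_mat_similar_mult_vec[OF V W VW WV A x] WVy[OF y] by simp
  qed
  hence key: "x \<in> unobservable_subspace (V * A * W) (C * W) \<longleftrightarrow>
      x \<in> carrier_vec N \<and> W *\<^sub>v x \<in> unobservable_subspace A C" for x
    unfolding unobservable_subspace_iff[OF Ah Ch] unobservable_subspace_iff[OF A C] using W by auto
  show ?thesis
  proof (intro equalityI subsetI)
    fix x assume "x \<in> unobservable_subspace (V * A * W) (C * W)"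
    thus "x \<in> (*\<^sub>v) V ` unobservable_subspace A C" using key VWy by (metis image_eqI)
  next
    fix x assume "x \<in> (*\<^sub>v) V ` unobservable_subspace A C"
    then obtain y where y: "y \<in> unobservable_subspace A C" "x = V *\<^sub>v y" by blast
    have "y \<in> carrier_vec N" using y(1) unobservable_subspace_iff[OF A C] by auto
    thus "x \<in> unobservable_subspace (V * A * W) (C * W)" unfolding key y(2) using y(1) WVy V by simp
  qed
qed

definition symp_complement :: "nat \<Rightarrow> real vec set \<Rightarrow> real vec set" where
  "symp_complement n S = {x \<in> carrier_vec (2*n). \<forall>s\<in>S. symp_form n s x = 0}"

lemma symp_complement_image:
  assumes V: "symplectic n V" and S: "S \<subseteq> carrier_vec (2*n)"
  shows "(*\<^sub>v) V ` symp_complement n S = symp_complement n ((*\<^sub>v) V ` S)"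
proof (intro equalityI subsetI)
  have Vc: "V \<in> carrier_mat (2*n) (2*n)" using V by (rule symplectic_carrier)
  fix x assume "x \<in> (*\<^sub>v) V ` symp_complement n S"
  then obtain y where y: "y \<in> carrier_vec (2*n)" "\<forall>s\<in>S. symp_form n s y = 0" "x = V *\<^sub>v y"
    unfolding symp_complement_def by blast
  thus "x \<in> symp_complement n ((*\<^sub>v) V ` S)"
    using S Vc symplectic_preserves_symp_form[OF V] unfolding symp_complement_def by auto
next
  have Vc: "V \<in> carrier_mat (2*n) (2*n)" using V by (rule symplectic_carrier)
  fix x assume x: "x \<in> symp_complement n ((*\<^sub>v) V ` S)"
  define y where "y = sharp V *\<^sub>v x"
  have xc: "x \<in> carrier_vec (2*n)" using x unfolding symp_complement_def by auto
  have yc: "y \<in> carrier_vec (2*n)" unfolding y_def using sharp_carrier[OF Vc] xc by simp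
  have xy: "x = V *\<^sub>v y" unfolding y_def using symplectic_inverse(2)[OF V xc] by simp
  have "symp_form n s y = 0" if "s \<in> S" for s
    using x that S yc symplectic_preserves_symp_form[OF V, of s y] unfolding symp_complement_def xy
    by auto
  thus "x \<in> (*\<^sub>v) V ` symp_complement n S" using xy yc unfolding symp_complement_def by blast
qed

lemma smult_mat_mult_vec:
  assumes "M \<in> carrier_mat nr nc" "v \<in> carrier_vec nc"
  shows "((c::real) \<cdot>\<^sub>m M) *\<^sub>v v = c \<cdot>\<^sub>v (M *\<^sub>v v)"
  using assms by (intro eq_vecI) (auto simp: scalar_prod_def sum_distrib_left mult.assoc)

lemma pow_mult_in_controllable_subspace:
  assumes A: "A \<in> carrier_mat N N" and B: "B \<in> carrier_mat N p" and j: "j < N"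
    and u: "u \<in> carrier_vec p"
  shows "A ^\<^sub>m j *\<^sub>v (B *\<^sub>v u) \<in> controllable_subspace A B"
proof -
  have AB: "A ^\<^sub>m j * B \<in> carrier_mat N p" using A B by (metis mult_carrier_mat pow_carrier_mat)
  have "A ^\<^sub>m j *\<^sub>v (B *\<^sub>v u) = (A ^\<^sub>m j * B) *\<^sub>v u"
    by (rule assoc_mult_mat_vec[symmetric]) (use A B u in auto)
  also have "\<dots> \<in> controllable_subspace A B"
    using pow_mult_col_in_controllable_subspace[OF A B j] col_mult2[OF pow_carrier_mat[OF A] B]
    by (intro mult_mat_vec_in_subspace[OF vec_subspace_controllable_subspace[OF A B] AB u]) simp
  finally show ?thesis .
qed

section \<open>The controllable and unobservable subspaces of a linear quantum system\<close>

locale linear_quantum_system =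
  fixes n m :: nat and R C \<Sigma> :: "real mat"
  assumes R: "R \<in> carrier_mat (2*n) (2*n)" "transpose_mat R = R"
    and C: "C \<in> carrier_mat (2*m) (2*n)"
    and Sigma: "symplectic m \<Sigma>"
begin

definition A_sys :: "real mat" where "A_sys = JJ n * R - (1/2) \<cdot>\<^sub>m (sharp C * C)"
definition B_sys :: "real mat" where "B_sys = - (sharp C * \<Sigma>)"

lemma Sigma_carrier: "\<Sigma> \<in> carrier_mat (2*m) (2*m)"
  using Sigma by (rule symplectic_carrier)

lemma A_sys_carrier: "A_sys \<in> carrier_mat (2*n) (2*n)"
  unfolding A_sys_def using R C sharp_carrier[OF C] by auto

lemma B_sys_carrier: "B_sys \<in> carrier_mat (2*n) (2*m)"
  unfolding B_sys_def using sharp_carrier[OF C] Sigma_carrier by auto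

lemma A_sys_mult_vec:
  assumes y: "y \<in> carrier_vec (2*n)"
  shows "A_sys *\<^sub>v y = Jvec n (R *\<^sub>v y) + (1/2) \<cdot>\<^sub>v Jvec n (transpose_mat C *\<^sub>v Jvec m (C *\<^sub>v y))"
proof -
  have sC: "sharp C \<in> carrier_mat (2*n) (2*m)" by (rule sharp_carrier[OF C])
  have "((1/2) \<cdot>\<^sub>m (sharp C * C)) *\<^sub>v y = (1/2) \<cdot>\<^sub>v (sharp C *\<^sub>v (C *\<^sub>v y))"
    using sC C y by (simp add: smult_mat_mult_vec[of _ "2*n" "2*n"] assoc_mult_mat_vec[of _ "2*n" "2*m"])
  moreover have "(JJ n * R) *\<^sub>v y = Jvec n (R *\<^sub>v y)"
    using R y by (simp add: assoc_mult_mat_vec[of _ "2*n" "2*n"] JJ_mult_vec)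
  moreover have "A_sys *\<^sub>v y = (JJ n * R) *\<^sub>v y - ((1/2) \<cdot>\<^sub>m (sharp C * C)) *\<^sub>v y"
    unfolding A_sys_def using R sC C y by (intro minus_mult_distrib_mat_vec) auto
  ultimately have "A_sys *\<^sub>v y = Jvec n (R *\<^sub>v y) - (1/2) \<cdot>\<^sub>v (sharp C *\<^sub>v (C *\<^sub>v y))" by simp
  thus ?thesis using sharp_mult_vec[OF C, of "C *\<^sub>v y"] C y by (auto intro!: eq_vecI)
qed

lemma symp_form_B_sys:
  assumes u: "u \<in> carrier_vec (2*m)" and z: "z \<in> carrier_vec (2*n)"
  shows "symp_form n (B_sys *\<^sub>v u) z = Jvec m (\<Sigma> *\<^sub>v u) \<bullet> (C *\<^sub>v z)"
proof -
  have v: "transpose_mat C *\<^sub>v Jvec m (\<Sigma> *\<^sub>v u) \<in> carrier_vec (2*n)" using C by auto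
  have "B_sys *\<^sub>v u = - (sharp C *\<^sub>v (\<Sigma> *\<^sub>v u))"
    unfolding B_sys_def using sharp_carrier[OF C] Sigma_carrier u
    by (simp add: assoc_mult_mat_vec[of _ "2*n" "2*m"])
  also have "\<dots> = Jvec n (transpose_mat C *\<^sub>v Jvec m (\<Sigma> *\<^sub>v u))"
    using sharp_mult_vec[OF C, of "\<Sigma> *\<^sub>v u"] Sigma_carrier u C by (auto intro!: eq_vecI)
  finally have "symp_form n (B_sys *\<^sub>v u) z = (transpose_mat C *\<^sub>v Jvec m (\<Sigma> *\<^sub>v u)) \<bullet> z"
    unfolding symp_form_def using scalar_prod_Jvec_Jvec[OF v z] by simp
  also have "\<dots> = Jvec m (\<Sigma> *\<^sub>v u) \<bullet> (C *\<^sub>v z)" by (rule transpose_vec_mult_scalar[OF C z]) simp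
  finally show ?thesis .
qed

text \<open>On \<open>ker C\<close> the dissipative part of \<open>A\<close> drops out and the Hamiltonian part \<open>J R\<close> is
  \<open>\<omega>\<close>-skew because \<open>R\<close> is symmetric.\<close>

lemma symp_form_A_sys:
  assumes y: "y \<in> carrier_vec (2*n)" and z: "z \<in> carrier_vec (2*n)" and Cz: "C *\<^sub>v z = 0\<^sub>v (2*m)"
  shows "symp_form n (A_sys *\<^sub>v y) z = - symp_form n y (A_sys *\<^sub>v z)"
proof -
  define P where "P = transpose_mat C *\<^sub>v Jvec m (C *\<^sub>v y)"
  have Pc: "P \<in> carrier_vec (2*n)" unfolding P_def using C by auto
  have Ry: "R *\<^sub>v y \<in> carrier_vec (2*n)" "R *\<^sub>v z \<in> carrier_vec (2*n)" using R y z by auto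
  have Pz: "P \<bullet> z = 0"
    unfolding P_def using transpose_vec_mult_scalar[OF C z, of "Jvec m (C *\<^sub>v y)"] Cz by simp
  have Rsym: "(R *\<^sub>v y) \<bullet> z = y \<bullet> (R *\<^sub>v z)"
    using transpose_vec_mult_scalar[OF R(1) z y] R(2) by simp
  have "symp_form n (A_sys *\<^sub>v y) z = Jvec n (R *\<^sub>v y) \<bullet> Jvec n z + (1/2) * (Jvec n P \<bullet> Jvec n z)"
    unfolding symp_form_def A_sys_mult_vec[OF y] P_def[symmetric] using Ry Pc z
    by (simp add: add_scalar_prod_distrib[of _ "2*n"])
  also have "\<dots> = y \<bullet> (R *\<^sub>v z)" using scalar_prod_Jvec_Jvec Ry Pc z Rsym Pz by simp
  finally have l: "symp_form n (A_sys *\<^sub>v y) z = y \<bullet> (R *\<^sub>v z)" .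
  have "transpose_mat C *\<^sub>v 0\<^sub>v (2*m) = 0\<^sub>v (2*n)" using C by auto
  hence "A_sys *\<^sub>v z = Jvec n (R *\<^sub>v z)"
    unfolding A_sys_mult_vec[OF z] Cz using Ry by (auto intro!: eq_vecI)
  thus ?thesis using l symp_form_Jvec_right[OF y Ry(2)] by simp
qed

lemma symp_form_pow_A_sys:
  assumes y: "y \<in> carrier_vec (2*n)" and z: "z \<in> carrier_vec (2*n)"
    and Cz: "\<And>i. i < j \<Longrightarrow> C *\<^sub>v (A_sys ^\<^sub>m i *\<^sub>v z) = 0\<^sub>v (2*m)"
  shows "symp_form n (A_sys ^\<^sub>m j *\<^sub>v y) z = (-1)^j * symp_form n y (A_sys ^\<^sub>m j *\<^sub>v z)"
  using y Cz
proof (induction j arbitrary: y)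
  case 0 thus ?case using A_sys_carrier z by simp
next
  case (Suc j y)
  note A = A_sys_carrier
  have Ay: "A_sys *\<^sub>v y \<in> carrier_vec (2*n)" using A Suc.prems(1) by simp
  have Ajz: "A_sys ^\<^sub>m j *\<^sub>v z \<in> carrier_vec (2*n)" using A z by simp
  have "A_sys ^\<^sub>m Suc j *\<^sub>v y = A_sys ^\<^sub>m j *\<^sub>v (A_sys *\<^sub>v y)"
    using pow_mat_mult_vec_add[OF A Suc.prems(1), of j 1] A by simp
  hence "symp_form n (A_sys ^\<^sub>m Suc j *\<^sub>v y) z = (-1)^j * symp_form n (A_sys *\<^sub>v y) (A_sys ^\<^sub>m j *\<^sub>v z)"
    using Suc.IH[OF Ay] Suc.prems(2) by simp
  also have "symp_form n (A_sys *\<^sub>v y) (A_sys ^\<^sub>m j *\<^sub>v z) = - symp_form n y (A_sys ^\<^sub>m Suc j *\<^sub>v z)"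
    using symp_form_A_sys[OF Suc.prems(1) Ajz Suc.prems(2)] pow_mat_Suc_mult_vec[OF A z] by simp
  finally show ?case by simp
qed

text \<open>The central structural fact: \<open>\<omega>(A\<^sup>j B u, x) = \<plusminus>\<langle>J \<Sigma> u, C A\<^sup>j x\<rangle>\<close> as long as \<open>C A\<^sup>i x = 0\<close> for
  \<open>i < j\<close>, and \<open>J \<Sigma>\<close> is onto, so \<open>x\<close> is \<open>\<omega>\<close>-orthogonal to the controllable subspace exactly
  when all \<open>C A\<^sup>j x\<close> vanish.\<close>

theorem unobservable_eq_symp_complement_controllable:
  "unobservable_subspace A_sys C = symp_complement n (controllable_subspace A_sys B_sys)"
proof -
  note A = A_sys_carrier and B = B_sys_carrier
  have pow_B: "symp_form n (A_sys ^\<^sub>m j *\<^sub>v (B_sys *\<^sub>v u)) x = (-1)^j * (Jvec m (\<Sigma> *\<^sub>v u) \<bullet> (C *\<^sub>v (A_sys ^\<^sub>m j *\<^sub>v x)))"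
    if "u \<in> carrier_vec (2*m)" "x \<in> carrier_vec (2*n)"
      "\<And>i. i < j \<Longrightarrow> C *\<^sub>v (A_sys ^\<^sub>m i *\<^sub>v x) = 0\<^sub>v (2*m)" for j u x
    using that B symp_form_pow_A_sys[of "B_sys *\<^sub>v u" x j] symp_form_B_sys[of u "A_sys ^\<^sub>m j *\<^sub>v x"] A
    by simp
  show ?thesis
  proof (intro equalityI subsetI)
    fix x assume "x \<in> unobservable_subspace A_sys C"
    hence x: "x \<in> carrier_vec (2*n)" and Z: "\<And>j. j < 2*n \<Longrightarrow> C *\<^sub>v (A_sys ^\<^sub>m j *\<^sub>v x) = 0\<^sub>v (2*m)"
      using unobservable_subspace_iff[OF A C] by auto
    define W where "W = {s \<in> carrier_vec (2*n). symp_form n s x = 0}"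
    have "vec_subspace (2*n) W"
      unfolding vec_subspace_def W_def using x
      by (auto simp: symp_form_def add_scalar_prod_distrib[of _ "2*n"])
    moreover have "A_sys ^\<^sub>m j *\<^sub>v col B_sys c \<in> W" if "j < 2*n" "c < 2*m" for j c
      using pow_B[OF _ x, of "unit_vec (2*m) c" j] Z that B A
      by (simp add: W_def mult_mat_unit_vec[OF B, symmetric] less_imp_le)
    ultimately have "controllable_subspace A_sys B_sys \<subseteq> W"
      by (intro controllable_subspace_least[OF A B]) auto
    thus "x \<in> symp_complement n (controllable_subspace A_sys B_sys)"
      using x unfolding W_def symp_complement_def by auto
  next
    fix x assume "x \<in> symp_complement n (controllable_subspace A_sys B_sys)"
    hence x: "x \<in> carrier_vec (2*n)"
      and H: "\<And>s. s \<in> controllable_subspace A_sys B_sys \<Longrightarrow> symp_form n s x = 0"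
      unfolding symp_complement_def by auto
    have "C *\<^sub>v (A_sys ^\<^sub>m j *\<^sub>v x) = 0\<^sub>v (2*m)" if "j < 2*n" for j
      using that
    proof (induction j rule: less_induct)
      case (less j)
      define w where "w = C *\<^sub>v (A_sys ^\<^sub>m j *\<^sub>v x)"
      have wc: "w \<in> carrier_vec (2*m)" unfolding w_def using C A x by simp
      define u where "u = sharp \<Sigma> *\<^sub>v (- Jvec m w)"
      have uc: "u \<in> carrier_vec (2*m)" unfolding u_def using sharp_carrier[OF Sigma_carrier] by simp
      have "Jvec m (\<Sigma> *\<^sub>v u) = w"
        unfolding u_def using symplectic_inverse(2)[OF Sigma, of "- Jvec m w"] wc
        by (simp add: Jvec_uminus Jvec_Jvec)
      hence "w \<bullet> w = 0"
        using H[OF pow_mult_in_controllable_subspace[OF A B less.prems uc]] pow_B[OF uc x, of j] less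
        unfolding w_def by simp
      thus ?case using scalar_prod_self_eq_0[OF wc] unfolding w_def by simp
    qed
    thus "x \<in> unobservable_subspace A_sys C" using unobservable_subspace_iff[OF A C] x by auto
  qed
qed

end

section \<open>Coordinate subspaces\<close>

lemma coord_span_Int: "coord_span N I \<inter> coord_span N J = coord_span N (I \<inter> J)"
  unfolding coord_span_def by auto

lemma orth_compl_coord_span: "orth_compl N (coord_span N I) = coord_span N ({..<N} - I)"
proof (intro equalityI subsetI)
  fix y assume "y \<in> orth_compl N (coord_span N I)"
  hence y: "y \<in> carrier_vec N" and H: "\<And>x. x \<in> coord_span N I \<Longrightarrow> y \<bullet> x = 0"
    unfolding orth_compl_def by auto
  have "y $ i = 0" if "i < N" "i \<in> I" for i
    using H[OF unit_vec_coord_span[OF that]] that y by simp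
  thus "y \<in> coord_span N ({..<N} - I)" using y unfolding coord_span_def by auto
next
  fix y assume y: "y \<in> coord_span N ({..<N} - I)"
  have "y \<bullet> x = 0" if x: "x \<in> coord_span N I" for x
  proof -
    have "dim_vec x = N" using x unfolding coord_span_def by auto
    hence "y \<bullet> x = (\<Sum>i<N. y $ i * x $ i)" by (simp add: scalar_prod_def lessThan_atLeast0)
    also have "\<dots> = 0"
      using coord_span_index_zero[OF x] coord_span_index_zero[OF y] by (intro sum.neutral) auto
    finally show ?thesis .
  qed
  thus "y \<in> orth_compl N (coord_span N I)" using y unfolding orth_compl_def coord_span_def by auto
qed

lemma idx_of_Int: "idx_of n k l X \<inter> idx_of n k l Y = idx_of n k l (X \<inter> Y)"
  unfolding idx_of_def by auto

lemma idx_of_compl: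
  assumes "X \<union> Y = {0,1,2,3,4,5}" "X \<inter> Y = {}"
  shows "{..<2*n} - idx_of n k l X = idx_of n k l Y"
proof -
  have "blk n k l i \<in> {0,1,2,3,4,5}" for i unfolding blk_def by auto
  thus ?thesis using assms unfolding idx_of_def by blast
qed

lemma normal_form_idx_eq_idx_of: "k + l \<le> n \<Longrightarrow> normal_form_idx n 0 k l = idx_of n k l {0,3,4}"
  unfolding normal_form_idx_def idx_of_def blk_def by auto

lemma symp_complement_coord_span:
  shows "symp_complement n (coord_span (2*n) (idx_of n k l {0,3,4})) = coord_span (2*n) (idx_of n k l {2,4,5})"
proof (intro equalityI subsetI)
  fix x assume "x \<in> symp_complement n (coord_span (2*n) (idx_of n k l {0,3,4}))"
  hence x: "x \<in> carrier_vec (2*n)"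
    and H: "\<And>s. s \<in> coord_span (2*n) (idx_of n k l {0,3,4}) \<Longrightarrow> symp_form n s x = 0"
    unfolding symp_complement_def by auto
  have "x $ i = 0" if i: "i < 2*n" "i \<notin> idx_of n k l {2,4,5}" for i
  proof (cases "i < n")
    case True
    hence "i + n \<in> idx_of n k l {0,3,4}" using i unfolding idx_of_def blk_def by (auto split: if_splits)
    thus ?thesis using H[OF unit_vec_coord_span] symp_form_unit_vec(2)[OF True x] True by simp
  next
    case False
    hence "i - n < n" "i - n \<in> idx_of n k l {0,3,4}" using i unfolding idx_of_def blk_def
      by (auto split: if_splits)
    thus ?thesis using H[OF unit_vec_coord_span] symp_form_unit_vec(1)[of "i - n" n x] x False
      by fastforce
  qed
  thus "x \<in> coord_span (2*n) (idx_of n k l {2,4,5})" using x unfolding coord_span_def by auto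
next
  fix x assume x: "x \<in> coord_span (2*n) (idx_of n k l {2,4,5})"
  have "symp_form n s x = 0" if s: "s \<in> coord_span (2*n) (idx_of n k l {0,3,4})" for s
  proof -
    have "symp_form n s x = (\<Sum>i<n. s$i * x$(i+n) - s$(i+n) * x$i)"
      using s x unfolding coord_span_def by (intro symp_form_sum) auto
    also have "\<dots> = 0"
    proof (intro sum.neutral ballI)
      fix i assume "i \<in> {..<n}"
      hence i: "i < n" by simp
      have "s $ i = 0 \<or> x $ (i+n) = 0"
        using coord_span_index_zero[OF s, of i] coord_span_index_zero[OF x, of "i+n"] i
        by (cases "i < k") (auto simp: idx_of_def blk_def)
      moreover have "s $ (i+n) = 0 \<or> x $ i = 0"
        using coord_span_index_zero[OF s, of "i+n"] coord_span_index_zero[OF x, of i] i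
        by (cases "i < k + l") (auto simp: idx_of_def blk_def)
      ultimately show "s$i * x$(i+n) - s$(i+n) * x$i = 0" by auto
    qed
    finally show ?thesis .
  qed
  thus "x \<in> symp_complement n (coord_span (2*n) (idx_of n k l {0,3,4}))"
    using x unfolding symp_complement_def coord_span_def by auto
qed

lemma invariant_coord_span_entry_zero:
  assumes M: "M \<in> carrier_mat N N" and inv: "\<And>x. x \<in> coord_span N I \<Longrightarrow> M *\<^sub>v x \<in> coord_span N I"
    and i: "i < N" "i \<notin> I" and j: "j < N" "j \<in> I"
  shows "M $$ (i,j) = 0"
  using coord_span_index_zero[OF inv[OF unit_vec_coord_span[OF j]] i] mult_mat_unit_vec[OF M j(1)] M i j
  by simp

lemma kernel_coord_span_entry_zero:
  assumes M: "M \<in> carrier_mat q N" and ker: "\<And>x. x \<in> coord_span N I \<Longrightarrow> M *\<^sub>v x = 0\<^sub>v q"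
    and i: "i < q" and j: "j < N" "j \<in> I"
  shows "M $$ (i,j) = 0"
proof -
  have "M $$ (i,j) = (M *\<^sub>v unit_vec N j) $ i" using mult_mat_unit_vec[OF M j(1)] M i j by simp
  thus ?thesis using ker[OF unit_vec_coord_span[OF j]] i by simp
qed

section \<open>The Kalman decomposition\<close>

lemma kalman_subspaces:
  assumes Ah: "Ah \<in> carrier_mat (2*n) (2*n)"
    and ctrl: "controllable_subspace Ah Bh = coord_span (2*n) (idx_of n k l {0,3,4})"
    and unobs: "unobservable_subspace Ah Ch = coord_span (2*n) (idx_of n k l {2,4,5})"
  shows "controllable_subspace Ah Bh \<inter> observable_subspace Ah Ch = coord_span (2*n) (idx_of n k l {0,3})"
    "controllable_subspace Ah Bh \<inter> unobservable_subspace Ah Ch = coord_span (2*n) (idx_of n k l {4})"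
    "uncontrollable_subspace Ah Bh \<inter> observable_subspace Ah Ch = coord_span (2*n) (idx_of n k l {1})"
    "uncontrollable_subspace Ah Bh \<inter> unobservable_subspace Ah Ch = coord_span (2*n) (idx_of n k l {2,5})"
proof -
  have d: "dim_row Ah = 2*n" using Ah by simp
  have "uncontrollable_subspace Ah Bh = coord_span (2*n) (idx_of n k l {1,2,5})"
    unfolding uncontrollable_subspace_def d ctrl orth_compl_coord_span by (subst idx_of_compl) auto
  moreover have "observable_subspace Ah Ch = coord_span (2*n) (idx_of n k l {0,1,3})"
    unfolding observable_subspace_def d unobs orth_compl_coord_span by (subst idx_of_compl) auto
  ultimately show "controllable_subspace Ah Bh \<inter> observable_subspace Ah Ch = coord_span (2*n) (idx_of n k l {0,3})"
    "controllable_subspace Ah Bh \<inter> unobservable_subspace Ah Ch = coord_span (2*n) (idx_of n k l {4})"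
    "uncontrollable_subspace Ah Bh \<inter> observable_subspace Ah Ch = coord_span (2*n) (idx_of n k l {1})"
    "uncontrollable_subspace Ah Bh \<inter> unobservable_subspace Ah Ch = coord_span (2*n) (idx_of n k l {2,5})"
    unfolding ctrl unobs by (simp_all add: coord_span_Int idx_of_Int insert_commute)
qed

lemma blk_range: "blk n k l i \<in> {0,1,2,3,4,5}"
  unfolding blk_def by auto

text \<open>Each block that is forced to vanish either maps a controllable coordinate out of the
  controllable subspace or an unobservable one out of the unobservable subspace.\<close>

lemma not_A_allowed_cases:
  assumes "r \<in> {0,1,2,3,4,5}" "c \<in> {0,1,2,3,4,5}" "\<not> A_allowed r c"
  shows "(c \<in> {0,3,4} \<and> r \<notin> {0,3,4}) \<or> (c \<in> {2,4,5} \<and> r \<notin> {2,4,5})"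
  using assms unfolding A_allowed_def by auto

lemma kalman_block_pattern:
  assumes Ah: "Ah \<in> carrier_mat (2*n) (2*n)" and Bh: "Bh \<in> carrier_mat (2*n) (2*m)"
    and Ch: "Ch \<in> carrier_mat (2*m) (2*n)"
    and ctrl: "controllable_subspace Ah Bh = coord_span (2*n) (idx_of n k l {0,3,4})"
    and unobs: "unobservable_subspace Ah Ch = coord_span (2*n) (idx_of n k l {2,4,5})"
  shows "\<forall>i<2*n. \<forall>j<2*n. \<not> A_allowed (blk n k l i) (blk n k l j) \<longrightarrow> Ah $$ (i,j) = 0"
    and "\<forall>i<2*n. \<forall>j<2*m. blk n k l i \<in> {1,2,5} \<longrightarrow> Bh $$ (i,j) = 0"
    and "\<forall>i<2*m. \<forall>j<2*n. blk n k l j \<in> {2,4,5} \<longrightarrow> Ch $$ (i,j) = 0"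
proof -
  show "\<forall>i<2*n. \<forall>j<2*n. \<not> A_allowed (blk n k l i) (blk n k l j) \<longrightarrow> Ah $$ (i,j) = 0"
  proof (intro allI impI)
    fix i j assume i: "i < 2*n" and j: "j < 2*n" and na: "\<not> A_allowed (blk n k l i) (blk n k l j)"
    from not_A_allowed_cases[OF blk_range blk_range na]
    show "Ah $$ (i,j) = 0"
    proof
      assume "blk n k l j \<in> {0,3,4} \<and> blk n k l i \<notin> {0,3,4}"
      thus ?thesis
        using controllable_subspace_invariant[OF Ah, of Bh] Bh i j unfolding ctrl
        by (intro invariant_coord_span_entry_zero[OF Ah]) (auto simp: idx_of_def)
    next
      assume "blk n k l j \<in> {2,4,5} \<and> blk n k l i \<notin> {2,4,5}"
      thus ?thesis
        using unobservable_subspace_invariant[OF Ah Ch] i j unfolding unobs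
        by (intro invariant_coord_span_entry_zero[OF Ah]) (auto simp: idx_of_def)
    qed
  qed
  show "\<forall>i<2*n. \<forall>j<2*m. blk n k l i \<in> {1,2,5} \<longrightarrow> Bh $$ (i,j) = 0"
  proof (intro allI impI)
    fix i j assume i: "i < 2*n" and j: "j < 2*m" and b: "blk n k l i \<in> {1,2,5}"
    have "Ah ^\<^sub>m 0 *\<^sub>v col Bh j \<in> controllable_subspace Ah Bh"
      using i by (intro pow_mult_col_in_controllable_subspace[OF Ah Bh _ j]) simp
    moreover have "col Bh j \<in> carrier_vec (2*n)" using Bh j by simp
    ultimately have "col Bh j \<in> coord_span (2*n) (idx_of n k l {0,3,4})" using Ah ctrl by simp
    thus "Bh $$ (i,j) = 0" using coord_span_index_zero[of "col Bh j" _ _ i] i j b Bh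
      by (auto simp: idx_of_def)
  qed
  show "\<forall>i<2*m. \<forall>j<2*n. blk n k l j \<in> {2,4,5} \<longrightarrow> Ch $$ (i,j) = 0"
  proof (intro allI impI)
    fix i j assume i: "i < 2*m" and j: "j < 2*n" and b: "blk n k l j \<in> {2,4,5}"
    have "Ch *\<^sub>v x = 0\<^sub>v (2*m)" if "x \<in> coord_span (2*n) (idx_of n k l {2,4,5})" for x
      using that j unobservable_subspace_iff[OF Ah Ch, of x] unfolding unobs
      by (auto simp: carrier_matD[OF Ah] dest!: spec[of _ 0])
    thus "Ch $$ (i,j) = 0"
      by (rule kernel_coord_span_entry_zero[OF Ch _ i j]) (use j b in \<open>auto simp: idx_of_def\<close>)
  qed
qed

context linear_quantum_system
begin

lemma symplectic_kalman_coordinates: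
  obtains V k l where "symplectic n V" "k + l \<le> n"
    "controllable_subspace (V * A_sys * sharp V) (V * B_sys) = coord_span (2*n) (idx_of n k l {0,3,4})"
    "unobservable_subspace (V * A_sys * sharp V) (C * sharp V) = coord_span (2*n) (idx_of n k l {2,4,5})"
proof -
  note A = A_sys_carrier and B = B_sys_carrier
  define S where "S = controllable_subspace A_sys B_sys"
  have S: "vec_subspace (2*n) S" unfolding S_def by (rule vec_subspace_controllable_subspace[OF A B])
  have "S \<subseteq> tail_vecs n 0" using vec_subspaceD(1)[OF S] unfolding tail_vecs_def by auto
  then obtain V k l where V: "acts_on_tail n 0 V" "0 + k + l \<le> n"
    "(*\<^sub>v) V ` S = coord_span (2*n) (normal_form_idx n 0 k l)"
    using subspace_normal_form_tail[OF _ S] by blast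
  hence V: "acts_on_tail n 0 V" "k + l \<le> n" "(*\<^sub>v) V ` S = coord_span (2*n) (idx_of n k l {0,3,4})"
    using normal_form_idx_eq_idx_of[of k l n] by auto
  have Vs: "symplectic n V" using V(1) unfolding acts_on_tail_def by simp
  hence Vc: "V \<in> carrier_mat (2*n) (2*n)" and VW: "V * sharp V = 1\<^sub>m (2*n)"
    and WV: "sharp V * V = 1\<^sub>m (2*n)" and Wc: "sharp V \<in> carrier_mat (2*n) (2*n)"
    unfolding symplectic_def using sharp_carrier by auto
  have "controllable_subspace (V * A_sys * sharp V) (V * B_sys) = coord_span (2*n) (idx_of n k l {0,3,4})"
    using controllable_subspace_similar[OF Vc Wc VW WV A B] V(3) unfolding S_def by simp
  moreover have "unobservable_subspace (V * A_sys * sharp V) (C * sharp V) = coord_span (2*n) (idx_of n k l {2,4,5})"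
    using unobservable_subspace_similar[OF Vc Wc VW WV A C] unobservable_eq_symp_complement_controllable
      symp_complement_image[OF Vs vec_subspaceD(1)[OF S]] V(3) symp_complement_coord_span
    unfolding S_def by simp
  ultimately show ?thesis using that Vs V(2) by blast
qed

end

theorem theorem1:
  fixes n m :: nat and R C \<Sigma> :: "real mat"
  assumes R: "R \<in> carrier_mat (2*n) (2*n)" "transpose_mat R = R"
    and C: "C \<in> carrier_mat (2*m) (2*n)"
    and Sigma: "symplectic m \<Sigma>"
  shows "\<exists>V k l. symplectic n V \<and> k + l \<le> n \<and>
    (let A = JJ n * R - (1/2) \<cdot>\<^sub>m (sharp C * C);
         B = - (sharp C * \<Sigma>);
         Ah = V * A * sharp V;
         Bh = V * B;
         Ch = C * sharp V
     in controllable_subspace Ah Bh \<inter> observable_subspace Ah Ch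
          = coord_span (2*n) (idx_of n k l {0,3})
      \<and> controllable_subspace Ah Bh \<inter> unobservable_subspace Ah Ch
          = coord_span (2*n) (idx_of n k l {4})
      \<and> uncontrollable_subspace Ah Bh \<inter> observable_subspace Ah Ch
          = coord_span (2*n) (idx_of n k l {1})
      \<and> uncontrollable_subspace Ah Bh \<inter> unobservable_subspace Ah Ch
          = coord_span (2*n) (idx_of n k l {2,5})
      \<and> controllable_subspace Ah Bh = coord_span (2*n) (idx_of n k l {0,3,4})
      \<and> unobservable_subspace Ah Ch = coord_span (2*n) (idx_of n k l {2,4,5})
      \<and> (\<forall>i<2*n. \<forall>j<2*n. \<not> A_allowed (blk n k l i) (blk n k l j) \<longrightarrow> Ah $$ (i,j) = 0)
      \<and> (\<forall>i<2*n. \<forall>j<2*m. blk n k l i \<in> {1,2,5} \<longrightarrow> Bh $$ (i,j) = 0)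
      \<and> (\<forall>i<2*m. \<forall>j<2*n. blk n k l j \<in> {2,4,5} \<longrightarrow> Ch $$ (i,j) = 0))"
proof -
  interpret linear_quantum_system n m R C \<Sigma> by unfold_locales (fact R C Sigma)+
  obtain V k l where V: "symplectic n V" "k + l \<le> n"
    and ctrl: "controllable_subspace (V * A_sys * sharp V) (V * B_sys) = coord_span (2*n) (idx_of n k l {0,3,4})"
    and unobs: "unobservable_subspace (V * A_sys * sharp V) (C * sharp V) = coord_span (2*n) (idx_of n k l {2,4,5})"
    by (rule symplectic_kalman_coordinates)
  have Vc: "V \<in> carrier_mat (2*n) (2*n)" using V(1) by (rule symplectic_carrier)
  have Ah: "V * A_sys * sharp V \<in> carrier_mat (2*n) (2*n)"
    using Vc A_sys_carrier sharp_carrier[OF Vc] by auto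
  have "V * B_sys \<in> carrier_mat (2*n) (2*m)" "C * sharp V \<in> carrier_mat (2*m) (2*n)"
    using Vc B_sys_carrier C sharp_carrier[OF Vc] by auto
  note blocks = kalman_block_pattern[OF Ah this ctrl unobs] and subspaces = kalman_subspaces[OF Ah ctrl unobs]
  show ?thesis
    unfolding Let_def A_sys_def[symmetric] B_sys_def[symmetric]
    by (intro exI[of _ V] exI[of _ k] exI[of _ l] conjI) (fact V ctrl unobs blocks subspaces)+
qed

end
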